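(* Let $E$ be the graph with vertex set $E^0=\{v,w,x\}$ whose edges are: exactly one edge $e$ from $v$ to $w$, exactly one edge $f$ from $w$ to $v$, (countably) infinitely many edges from $v$ to $x$, infinitely many edges from $w$ to $x$, and no other edges. Let $H:=\{x\}$ and $S:=\{v,w\}$. Then $(H,S)$ is an admissible pair for $E$, and the gauge-invariant ideal $I_{(H,S)}$ of $C^*(E)$ is not isomorphic (as a $C^*$-algebra) to $C^*({}_HE_S)$.
   Context: A graph $E=(E^0,E^1,r,s)$ consists of a set $E^0$ of vertices, a set $E^1$ of edges, and maps $r,s:E^1\to E^0$ (range and source). A vertex $u$ is regular if $0<|s^{-1}(u)|<\infty$; $E^0_{\mathrm{reg}}$ is the set of regular vertices. A path of length $n\ge 1$ is a sequence $\alpha=e_1\ldots e_n$ of edges with $r(e_i)=s(e_{i+1})$; $s(\alpha)=s(e_1)$, $r(\alpha)=r(e_n)$. $C^*(E)$ is the universal $C^*$-algebra generated by mutually orthogonal projections $\{p_u:u\in E^0\}$ and partial isometries with mutually orthogonal ranges $\{s_g:g\in E^1\}$ satisfying: (1) $s_g^*s_g=p_{r(g)}$ for all $g\in E^1$; (2) $s_gs_g^*\le p_{s(g)}$ for all $g\in E^1$; (3) $p_u=\sum_{\{g\in E^1: s(g)=u\}}s_gs_g^*$ for all $u\in E^0_{\mathrm{reg}}$. A subset $H\subseteq E^0$ is hereditary if $g\in E^1$ and $s(g)\in H$ imply $r(g)\in H$; a hereditary $H$ is saturated if every $u\in E^0_{\mathrm{reg}}$ with $r(s^{-1}(u))\subseteq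 H$ belongs to $H$. The breaking vertices of a saturated hereditary $H$ are $B_H:=\{u\in E^0: |s^{-1}(u)|=\infty \text{ and } 0<|s^{-1}(u)\cap r^{-1}(E^0\setminus H)|<\infty\}$. An admissible pair $(H,S)$ consists of a saturated hereditary subset $H$ and a subset $S\subseteq B_H$. For $u\in B_H$, $p_u^H:=p_u-\sum_{s(g)=u,\ r(g)\notin H}s_gs_g^*$. $I_{(H,S)}$ is the closed two-sided ideal of $C^*(E)$ generated by $\{p_u:u\in H\}\cup\{p_u^H:u\in S\}$. The graph ${}_HE_S$ (construction of Deicke, Hong and Szymański), for an admissible pair with $H\neq\emptyset$: let $\widetilde{F}_E(H,S)$ be the collection of all paths of positive length $\alpha=e_1\ldots e_n$ in $E$ with $s(\alpha)\notin H$, $r(\alpha)\in H\cup S$, and $r(e_i)\notin H\cup S$ for $1\le i\le n-1$. Let $F_E(H,S)=\widetilde{F}_E(H,S)\setminus\{g\in E^1:s(g)\in S \text{ and } r(g)\in H\}$, and let $\overline{F}_E(H,S)$ be another copy of $F_E(H,S)$, with $\overline{\alpha}$ the copy of $\alpha$. Then ${}_HE_S$ is the graph with vertex set ${}_HE_S^0:=H\cup S\cup F_E(H,S)$ (disjoint union) and edge set ${}_HE_S^1:=\{g\in E^1:s(g)\in H\}\cup\{g\in E^1:s(g)\in S,\ r(g)\in H\}\cup\overline{F}_E(H,S)$, where edges from $E^1$ keep their source and range, and $s(\overline{\alpha})=\alpha$, $r(\overline{\alpha})=r(\alpha)$. *)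

theory Defs
  imports "HOL-Analysis.Analysis" "HOL-Library.Poly_Mapping" "Graph_Theory.Arc_Walk"
begin

section \<open>The free complex *-algebra on a set of generators\<close>

datatype 'g letter = Gen (base: 'g) | Adj (base: 'g)

primrec adj_letter :: "'g letter \<Rightarrow> 'g letter" where
  "adj_letter (Gen g) = Adj g"
| "adj_letter (Adj g) = Gen g"

datatype 'g fword = Word (letters: "'g letter list")

instantiation fword :: (type) monoid_add
begin
definition zero_fword :: "'a fword" where "zero_fword = Word []"
definition plus_fword :: "'a fword \<Rightarrow> 'a fword \<Rightarrow> 'a fword"
  where "plus_fword u w = Word (letters u @ letters w)"
instance by standard (auto simp: zero_fword_def plus_fword_def)
end

definition adj_word :: "'g fword \<Rightarrow> 'g fword" where
  "adj_word w = Word (rev (map adj_letter (letters w)))"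

text \<open>
  The type \<open>'g free_alg\<close> carries the ring structure of the \<^emph>\<open>unital\<close> free algebra (concatenation
  of words, extended bilinearly). The free *-algebra itself is its subset of elements without
  constant term, since a graph algebra need not have a unit.
\<close>

type_synonym 'g free_alg = "'g fword \<Rightarrow>\<^sub>0 complex"

definition free_star_alg :: "'g set \<Rightarrow> 'g free_alg set" where
  "free_star_alg \<Gamma> = {a. \<forall>w \<in> Poly_Mapping.keys a. letters w \<noteq> [] \<and> base ` set (letters w) \<subseteq> \<Gamma>}"

definition gen :: "'g \<Rightarrow> 'g free_alg" where
  "gen g = Poly_Mapping.single (Word [Gen g]) 1"

definition fscale :: "complex \<Rightarrow> 'g free_alg \<Rightarrow> 'g free_alg" where
  "fscale c a = Poly_Mapping.single 0 c * a"

definition fstar :: "'g free_alg \<Rightarrow> 'g free_alg" where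
  "fstar a = Poly_Mapping.map_key adj_word (Poly_Mapping.map cnj a)"

lemma adj_letter_idem [simp]: "adj_letter (adj_letter x) = x"
  by (cases x) auto

lemma base_adj_letter [simp]: "base (adj_letter x) = base x"
  by (cases x) auto

lemma adj_word_idem [simp]: "adj_word (adj_word w) = w"
  by (cases w) (simp add: adj_word_def rev_map comp_def)

lemma inj_adj_word: "inj adj_word"
  by (metis adj_word_idem injI)

lemma adj_word_add: "adj_word (u + w) = adj_word w + adj_word u"
  by (simp add: adj_word_def plus_fword_def)

lemma adj_word_zero [simp]: "adj_word 0 = 0"
  by (simp add: adj_word_def zero_fword_def)

lemma lookup_fstar: "Poly_Mapping.lookup (fstar a) w = cnj (Poly_Mapping.lookup a (adj_word w))"
  by (simp add: fstar_def Poly_Mapping.map_key.rep_eq[OF inj_adj_word] Poly_Mapping.map.rep_eq when_def)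

lemma fstar_fstar [simp]: "fstar (fstar a) = a"
  by (rule poly_mapping_eqI) (simp add: lookup_fstar)

lemma fstar_add: "fstar (a + b) = fstar a + fstar b"
  by (rule poly_mapping_eqI) (simp add: lookup_fstar lookup_add)

lemma fstar_minus: "fstar (a - b) = fstar a - fstar b"
  by (rule poly_mapping_eqI) (simp add: lookup_fstar lookup_minus)

lemma fstar_zero [simp]: "fstar 0 = 0"
  by (rule poly_mapping_eqI) (simp add: lookup_fstar)

lemma fstar_single: "fstar (Poly_Mapping.single w c) = Poly_Mapping.single (adj_word w) (cnj c)"
  by (rule poly_mapping_eqI) (auto simp: lookup_fstar lookup_single when_def)

lemma free_alg_eq_sum:
  "(a :: 'g free_alg) = (\<Sum>w \<in> Poly_Mapping.keys a. Poly_Mapping.single w (Poly_Mapping.lookup a w))"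
  by (rule poly_mapping_eqI)
    (simp add: lookup_sum lookup_single when_def in_keys_iff sum.delta')

lemma free_alg_induct [case_names zero add]:
  fixes P :: "'g free_alg \<Rightarrow> bool"
  assumes "P 0" "\<And>w c a. P a \<Longrightarrow> P (Poly_Mapping.single w c + a)"
  shows "P a"
proof -
  have "P (\<Sum>w \<in> K. Poly_Mapping.single w (Poly_Mapping.lookup a w))" if "finite K" for K
    using that by induction (auto intro: assms)
  then show ?thesis using free_alg_eq_sum[of a] by (metis finite_keys)
qed

lemma fstar_mult: "fstar (a * b) = fstar b * fstar a"
proof (induction a rule: free_alg_induct)
  case (add w c a)
  have "fstar (Poly_Mapping.single w c * b) = fstar b * fstar (Poly_Mapping.single w c)"
    by (induction b rule: free_alg_induct)
      (simp_all add: distrib_left distrib_right fstar_add fstar_single mult_single adj_word_add mult.commute)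
  with add show ?case by (simp add: distrib_left distrib_right fstar_add)
qed simp

lemma const_central: "Poly_Mapping.single 0 c * a = a * Poly_Mapping.single 0 (c::complex)"
  for a :: "'g free_alg"
  by (induction a rule: free_alg_induct) (simp_all add: distrib_left distrib_right mult_single mult.commute)

lemma fscale_mult: "fscale c a * b = fscale c (a * b)" "a * fscale c b = fscale c (a * b)"
  by (simp_all add: fscale_def mult.assoc) (metis const_central mult.assoc)

lemma fscale_add: "fscale c (a + b) = fscale c a + fscale c b"
    "fscale (c + d) a = fscale c a + fscale d a"
    "fscale c (a - b) = fscale c a - fscale c b"
  by (simp_all add: fscale_def distrib_left distrib_right single_add right_diff_distrib)

lemma fscale_fscale: "fscale c (fscale d a) = fscale (c * d) a"
  by (simp add: fscale_def mult_single flip: mult.assoc)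

lemma fscale_one [simp]: "fscale 1 a = a" by (simp add: fscale_def)
lemma fscale_zero [simp]: "fscale c 0 = 0" by (simp add: fscale_def)
lemma fscale_minus1: "fscale (-1) a = - a"
  by (simp add: fscale_def single_uminus)

lemma fstar_fscale: "fstar (fscale c a) = fscale (cnj c) (fstar a)"
  by (simp add: fscale_def fstar_mult fstar_single const_central)

lemma fscale_single: "fscale c (Poly_Mapping.single w d) = Poly_Mapping.single w (c * d)"
  by (simp add: fscale_def mult_single)

lemma free_zero: "0 \<in> free_star_alg \<Gamma>" by (simp add: free_star_alg_def)

lemma free_add: "a \<in> free_star_alg \<Gamma> \<Longrightarrow> b \<in> free_star_alg \<Gamma> \<Longrightarrow> a + b \<in> free_star_alg \<Gamma>"
  using Poly_Mapping.keys_add[of a b] by (fastforce simp: free_star_alg_def)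

lemma free_mult:
  assumes "a \<in> free_star_alg \<Gamma>" "b \<in> free_star_alg \<Gamma>"
  shows "a * b \<in> free_star_alg \<Gamma>"
  unfolding free_star_alg_def
proof safe
  fix w assume "w \<in> Poly_Mapping.keys (a * b)"
  then obtain u v where w: "w = u + v" "u \<in> Poly_Mapping.keys a" "v \<in> Poly_Mapping.keys b"
    using keys_mult[of a b] by blast
  with assms have *: "letters u \<noteq> []" "base ` set (letters u) \<subseteq> \<Gamma>" "base ` set (letters v) \<subseteq> \<Gamma>"
    by (auto simp: free_star_alg_def)
  show "letters w = [] \<Longrightarrow> False" using w * by (simp add: plus_fword_def)
  show "base x \<in> \<Gamma>" if "x \<in> set (letters w)" for x using w * that by (auto simp: plus_fword_def)
qed

lemma free_fscale:
  assumes "a \<in> free_star_alg \<Gamma>" shows "fscale c a \<in> free_star_alg \<Gamma>"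
proof -
  have "Poly_Mapping.keys (fscale c a) \<subseteq> Poly_Mapping.keys a"
    using keys_mult[of "Poly_Mapping.single 0 c" a] by (auto simp: fscale_def split: if_splits)
  with assms show ?thesis by (auto simp: free_star_alg_def)
qed

lemma free_uminus: "a \<in> free_star_alg \<Gamma> \<Longrightarrow> - a \<in> free_star_alg \<Gamma>"
  using free_fscale[of a \<Gamma> "-1"] by (simp add: fscale_minus1)

lemma free_minus: "a \<in> free_star_alg \<Gamma> \<Longrightarrow> b \<in> free_star_alg \<Gamma> \<Longrightarrow> a - b \<in> free_star_alg \<Gamma>"
  using free_add[of a \<Gamma> "-b"] free_uminus[of b] by simp

lemma free_fstar:
  assumes "a \<in> free_star_alg \<Gamma>" shows "fstar a \<in> free_star_alg \<Gamma>"
  unfolding free_star_alg_def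
proof safe
  fix w assume "w \<in> Poly_Mapping.keys (fstar a)"
  then have "adj_word w \<in> Poly_Mapping.keys a" by (simp add: in_keys_iff lookup_fstar)
  with assms have *: "letters (adj_word w) \<noteq> []" "base ` set (letters (adj_word w)) \<subseteq> \<Gamma>"
    by (auto simp: free_star_alg_def)
  show "letters w = [] \<Longrightarrow> False" using * by (simp add: adj_word_def)
  show "base x \<in> \<Gamma>" if "x \<in> set (letters w)" for x
    using * that by (auto simp: adj_word_def image_image)
qed

lemma free_gen: "g \<in> \<Gamma> \<Longrightarrow> gen g \<in> free_star_alg \<Gamma>"
  by (simp add: free_star_alg_def gen_def)

lemma free_sum: "(\<And>i. i \<in> K \<Longrightarrow> f i \<in> free_star_alg \<Gamma>) \<Longrightarrow> sum f K \<in> free_star_alg \<Gamma>"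
  by (induction K rule: infinite_finite_induct) (auto intro: free_add free_zero)

lemmas free_closed = free_zero free_add free_mult free_fscale free_uminus free_minus free_fstar free_gen


section \<open>C*-algebras\<close>

record 'a cstar_alg =
  carr :: "'a set"
  czero :: 'a
  cadd :: "'a \<Rightarrow> 'a \<Rightarrow> 'a"
  cscale :: "complex \<Rightarrow> 'a \<Rightarrow> 'a"
  cmult :: "'a \<Rightarrow> 'a \<Rightarrow> 'a"
  cstar :: "'a \<Rightarrow> 'a"
  cnorm :: "'a \<Rightarrow> real"

definition cdist :: "'a cstar_alg \<Rightarrow> 'a \<Rightarrow> 'a \<Rightarrow> real" where
  "cdist A a b = cnorm A (cadd A a (cscale A (-1) b))"

locale cstar_algebra =
  fixes A :: "'a cstar_alg"
  assumes zero_closed: "czero A \<in> carr A"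
    and add_closed: "\<lbrakk>a \<in> carr A; b \<in> carr A\<rbrakk> \<Longrightarrow> cadd A a b \<in> carr A"
    and scale_closed: "a \<in> carr A \<Longrightarrow> cscale A c a \<in> carr A"
    and mult_closed: "\<lbrakk>a \<in> carr A; b \<in> carr A\<rbrakk> \<Longrightarrow> cmult A a b \<in> carr A"
    and star_closed: "a \<in> carr A \<Longrightarrow> cstar A a \<in> carr A"
    and add_assoc: "\<lbrakk>a \<in> carr A; b \<in> carr A; d \<in> carr A\<rbrakk>
          \<Longrightarrow> cadd A (cadd A a b) d = cadd A a (cadd A b d)"
    and add_commute: "\<lbrakk>a \<in> carr A; b \<in> carr A\<rbrakk> \<Longrightarrow> cadd A a b = cadd A b a"
    and add_zero: "a \<in> carr A \<Longrightarrow> cadd A a (czero A) = a"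
    and add_neg: "a \<in> carr A \<Longrightarrow> cadd A a (cscale A (-1) a) = czero A"
    and scale_add_right: "\<lbrakk>a \<in> carr A; b \<in> carr A\<rbrakk>
          \<Longrightarrow> cscale A c (cadd A a b) = cadd A (cscale A c a) (cscale A c b)"
    and scale_add_left: "a \<in> carr A \<Longrightarrow> cscale A (c + c') a = cadd A (cscale A c a) (cscale A c' a)"
    and scale_scale: "a \<in> carr A \<Longrightarrow> cscale A c (cscale A c' a) = cscale A (c * c') a"
    and scale_one: "a \<in> carr A \<Longrightarrow> cscale A 1 a = a"
    and mult_assoc: "\<lbrakk>a \<in> carr A; b \<in> carr A; d \<in> carr A\<rbrakk>
          \<Longrightarrow> cmult A (cmult A a b) d = cmult A a (cmult A b d)"
    and mult_add_left: "\<lbrakk>a \<in> carr A; b \<in> carr A; d \<in> carr A\<rbrakk>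
          \<Longrightarrow> cmult A (cadd A a b) d = cadd A (cmult A a d) (cmult A b d)"
    and mult_add_right: "\<lbrakk>a \<in> carr A; b \<in> carr A; d \<in> carr A\<rbrakk>
          \<Longrightarrow> cmult A d (cadd A a b) = cadd A (cmult A d a) (cmult A d b)"
    and mult_scale_left: "\<lbrakk>a \<in> carr A; b \<in> carr A\<rbrakk>
          \<Longrightarrow> cmult A (cscale A c a) b = cscale A c (cmult A a b)"
    and mult_scale_right: "\<lbrakk>a \<in> carr A; b \<in> carr A\<rbrakk>
          \<Longrightarrow> cmult A a (cscale A c b) = cscale A c (cmult A a b)"
    and star_star: "a \<in> carr A \<Longrightarrow> cstar A (cstar A a) = a"
    and star_add: "\<lbrakk>a \<in> carr A; b \<in> carr A\<rbrakk>
          \<Longrightarrow> cstar A (cadd A a b) = cadd A (cstar A a) (cstar A b)"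
    and star_scale: "a \<in> carr A \<Longrightarrow> cstar A (cscale A c a) = cscale A (cnj c) (cstar A a)"
    and star_mult: "\<lbrakk>a \<in> carr A; b \<in> carr A\<rbrakk>
          \<Longrightarrow> cstar A (cmult A a b) = cmult A (cstar A b) (cstar A a)"
    and norm_eq_0_iff: "a \<in> carr A \<Longrightarrow> cnorm A a = 0 \<longleftrightarrow> a = czero A"
    and norm_triangle: "\<lbrakk>a \<in> carr A; b \<in> carr A\<rbrakk> \<Longrightarrow> cnorm A (cadd A a b) \<le> cnorm A a + cnorm A b"
    and norm_scale: "a \<in> carr A \<Longrightarrow> cnorm A (cscale A c a) = cmod c * cnorm A a"
    and norm_mult: "\<lbrakk>a \<in> carr A; b \<in> carr A\<rbrakk> \<Longrightarrow> cnorm A (cmult A a b) \<le> cnorm A a * cnorm A b"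
    and norm_star_mult: "a \<in> carr A \<Longrightarrow> cnorm A (cmult A (cstar A a) a) = (cnorm A a)\<^sup>2"
    and complete: "\<lbrakk>\<And>n. X n \<in> carr A;
            \<And>\<epsilon>. \<epsilon> > 0 \<Longrightarrow> \<exists>N. \<forall>m\<ge>N. \<forall>n\<ge>N. cdist A (X m) (X n) < \<epsilon>\<rbrakk>
          \<Longrightarrow> \<exists>a \<in> carr A. (\<lambda>n. cdist A (X n) a) \<longlonglongrightarrow> 0"

definition star_hom :: "'a cstar_alg \<Rightarrow> 'b cstar_alg \<Rightarrow> ('a \<Rightarrow> 'b) \<Rightarrow> bool" where
  "star_hom A B \<phi> \<longleftrightarrow>
     \<phi> \<in> carr A \<rightarrow> carr B \<and>
     (\<forall>a \<in> carr A. \<forall>b \<in> carr A. \<phi> (cadd A a b) = cadd B (\<phi> a) (\<phi> b)) \<and>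
     (\<forall>c. \<forall>a \<in> carr A. \<phi> (cscale A c a) = cscale B c (\<phi> a)) \<and>
     (\<forall>a \<in> carr A. \<forall>b \<in> carr A. \<phi> (cmult A a b) = cmult B (\<phi> a) (\<phi> b)) \<and>
     (\<forall>a \<in> carr A. \<phi> (cstar A a) = cstar B (\<phi> a))"

text \<open>A bijective *-homomorphism between C*-algebras is automatically isometric.\<close>

definition cstar_isomorphic :: "'a cstar_alg \<Rightarrow> 'b cstar_alg \<Rightarrow> bool" where
  "cstar_isomorphic A B \<longleftrightarrow> (\<exists>\<phi>. star_hom A B \<phi> \<and> bij_betw \<phi> (carr A) (carr B))"

definition closed_ideal :: "'a cstar_alg \<Rightarrow> 'a set \<Rightarrow> bool" where
  "closed_ideal A I \<longleftrightarrow>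
     I \<subseteq> carr A \<and> czero A \<in> I \<and>
     (\<forall>a \<in> I. \<forall>b \<in> I. cadd A a b \<in> I) \<and>
     (\<forall>c. \<forall>a \<in> I. cscale A c a \<in> I) \<and>
     (\<forall>a \<in> I. \<forall>b \<in> carr A. cmult A a b \<in> I \<and> cmult A b a \<in> I) \<and>
     (\<forall>X. \<forall>a \<in> carr A. (\<forall>n. X n \<in> I) \<and> (\<lambda>n. cdist A (X n) a) \<longlonglongrightarrow> 0 \<longrightarrow> a \<in> I)"

definition ideal_generated :: "'a cstar_alg \<Rightarrow> 'a set \<Rightarrow> 'a set" where
  "ideal_generated A X = \<Inter> {I. closed_ideal A I \<and> X \<subseteq> I}"


section \<open>The universal C*-algebra on generators and relations\<close>

definition cstar_seminorm :: "'g set \<Rightarrow> ('g free_alg \<Rightarrow> real) \<Rightarrow> bool" where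
  "cstar_seminorm \<Gamma> q \<longleftrightarrow>
     (\<forall>a \<in> free_star_alg \<Gamma>. \<forall>b \<in> free_star_alg \<Gamma>.
        q (a + b) \<le> q a + q b \<and> q (a * b) \<le> q a * q b) \<and>
     (\<forall>a \<in> free_star_alg \<Gamma>. \<forall>c. q (fscale c a) = cmod c * q a) \<and>
     (\<forall>a \<in> free_star_alg \<Gamma>. q (fstar a * a) = (q a)\<^sup>2)"

text \<open>
  The largest C*-seminorm annihilating the relators \<open>R\<close>. Quantifying over C*-seminorms instead of
  *-representations (each of which yields one, and conversely) avoids any bound on the size of the
  representing algebras. The supremum is meaningful for relators that bound the norms of the
  generators; see \<open>CK_seminorm_bdd\<close> below for graph algebras.
\<close>

definition univ_norm :: "'g set \<Rightarrow> 'g free_alg set \<Rightarrow> 'g free_alg \<Rightarrow> real" where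
  "univ_norm \<Gamma> R a = (SUP q \<in> {q. cstar_seminorm \<Gamma> q \<and> (\<forall>r \<in> R. q r = 0)}. q a)"

definition cauchy_seqs :: "'g set \<Rightarrow> ('g free_alg \<Rightarrow> real) \<Rightarrow> (nat \<Rightarrow> 'g free_alg) set" where
  "cauchy_seqs \<Gamma> q = {X. (\<forall>n. X n \<in> free_star_alg \<Gamma>) \<and>
     (\<forall>\<epsilon>>0. \<exists>N. \<forall>m\<ge>N. \<forall>n\<ge>N. q (X m - X n) < \<epsilon>)}"

definition null_rel :: "'g set \<Rightarrow> ('g free_alg \<Rightarrow> real) \<Rightarrow> ((nat \<Rightarrow> 'g free_alg) \<times> (nat \<Rightarrow> 'g free_alg)) set"
  where "null_rel \<Gamma> q = {(X, Y). X \<in> cauchy_seqs \<Gamma> q \<and> Y \<in> cauchy_seqs \<Gamma> q \<and>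
     (\<lambda>n. q (X n - Y n)) \<longlonglongrightarrow> 0}"

definition rep :: "'x set \<Rightarrow> 'x" where
  "rep \<xi> = (SOME X. X \<in> \<xi>)"

text \<open>The Hausdorff completion of the free *-algebra with respect to the seminorm \<open>q\<close>.\<close>

definition completion :: "'g set \<Rightarrow> ('g free_alg \<Rightarrow> real) \<Rightarrow> (nat \<Rightarrow> 'g free_alg) set cstar_alg" where
  "completion \<Gamma> q =
    \<lparr> carr = cauchy_seqs \<Gamma> q // null_rel \<Gamma> q,
      czero = null_rel \<Gamma> q `` {\<lambda>n. 0},
      cadd = (\<lambda>\<xi> \<eta>. null_rel \<Gamma> q `` {\<lambda>n. rep \<xi> n + rep \<eta> n}),
      cscale = (\<lambda>c \<xi>. null_rel \<Gamma> q `` {\<lambda>n. fscale c (rep \<xi> n)}),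
      cmult = (\<lambda>\<xi> \<eta>. null_rel \<Gamma> q `` {\<lambda>n. rep \<xi> n * rep \<eta> n}),
      cstar = (\<lambda>\<xi>. null_rel \<Gamma> q `` {\<lambda>n. fstar (rep \<xi> n)}),
      cnorm = (\<lambda>\<xi>. lim (\<lambda>n. q (rep \<xi> n))) \<rparr>"

definition universal_cstar :: "'g set \<Rightarrow> 'g free_alg set \<Rightarrow> (nat \<Rightarrow> 'g free_alg) set cstar_alg" where
  "universal_cstar \<Gamma> R = completion \<Gamma> (univ_norm \<Gamma> R)"

definition univ_embed :: "'g set \<Rightarrow> 'g free_alg set \<Rightarrow> 'g free_alg \<Rightarrow> (nat \<Rightarrow> 'g free_alg) set" where
  "univ_embed \<Gamma> R a = null_rel \<Gamma> (univ_norm \<Gamma> R) `` {\<lambda>n. a}"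


locale cstar_seminormed =
  fixes \<Gamma> :: "'g set" and q :: "'g free_alg \<Rightarrow> real"
  assumes q: "cstar_seminorm \<Gamma> q"
begin

abbreviation "F \<equiv> free_star_alg \<Gamma>"
abbreviation "CS \<equiv> cauchy_seqs \<Gamma> q"
abbreviation "cls X \<equiv> null_rel \<Gamma> q `` {X}"
abbreviation "C \<equiv> completion \<Gamma> q"

lemma q_triangle: "a \<in> F \<Longrightarrow> b \<in> F \<Longrightarrow> q (a + b) \<le> q a + q b"
  and q_mult: "a \<in> F \<Longrightarrow> b \<in> F \<Longrightarrow> q (a * b) \<le> q a * q b"
  and q_scale: "a \<in> F \<Longrightarrow> q (fscale c a) = cmod c * q a"
  and q_star_mult: "a \<in> F \<Longrightarrow> q (fstar a * a) = (q a)\<^sup>2"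
  using q by (auto simp: cstar_seminorm_def)

lemma q_zero [simp]: "q 0 = 0"
  using q_scale[of 0 0] by (simp add: free_zero)

lemma q_uminus: "a \<in> F \<Longrightarrow> q (- a) = q a"
  using q_scale[of a "-1"] by (simp add: fscale_minus1)

lemma q_nonneg: "a \<in> F \<Longrightarrow> q a \<ge> 0"
  using q_triangle[of a "-a"] q_uminus[of a] by (simp add: free_closed)

lemma q_diff_commute: "a \<in> F \<Longrightarrow> b \<in> F \<Longrightarrow> q (a - b) = q (b - a)"
  using q_uminus[of "a - b"] by (simp add: free_closed)

lemma q_triangle3: "a \<in> F \<Longrightarrow> b \<in> F \<Longrightarrow> c \<in> F \<Longrightarrow> q (a - c) \<le> q (a - b) + q (b - c)"
  using q_triangle[of "a - b" "b - c"] by (simp add: free_closed)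

lemma q_abs_diff: "a \<in> F \<Longrightarrow> b \<in> F \<Longrightarrow> \<bar>q a - q b\<bar> \<le> q (a - b)"
  using q_triangle[of "a - b" b] q_triangle[of "b - a" a] q_diff_commute[of a b]
  by (simp add: free_closed)

lemma q_star: assumes "a \<in> F" shows "q (fstar a) = q a"
proof -
  have le: "q b \<le> q (fstar b)" if "b \<in> F" for b
  proof (cases "q b = 0")
    case False
    have "q b * q b \<le> q (fstar b) * q b"
      using q_star_mult[OF that] q_mult[of "fstar b" b] that by (simp add: free_closed power2_eq_square)
    then show ?thesis using False q_nonneg[OF that] by (simp add: mult_le_cancel_right)
  qed (use that in \<open>simp add: q_nonneg free_closed\<close>)
  show ?thesis using le[of a] le[of "fstar a"] assms by (simp add: free_closed)
qed

lemma q_mult_diff: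
  assumes "a \<in> F" "b \<in> F" "a' \<in> F" "b' \<in> F"
  shows "q (a * b - a' * b') \<le> q a * q (b - b') + q (a - a') * q b'"
proof -
  have "a * b - a' * b' = a * (b - b') + (a - a') * b'" by (simp add: algebra_simps)
  also have "q \<dots> \<le> q (a * (b - b')) + q ((a - a') * b')"
    by (rule q_triangle) (simp_all add: assms free_closed)
  also have "\<dots> \<le> q a * q (b - b') + q (a - a') * q b'"
    by (intro add_mono q_mult) (simp_all add: assms free_closed)
  finally show ?thesis .
qed

lemma CS_in: "X \<in> CS \<Longrightarrow> X n \<in> F" by (simp add: cauchy_seqs_def)

lemma CS_cauchy: "X \<in> CS \<Longrightarrow> \<epsilon> > 0 \<Longrightarrow> \<exists>N. \<forall>m\<ge>N. \<forall>n\<ge>N. q (X m - X n) < \<epsilon>"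
  by (simp add: cauchy_seqs_def)

lemma CS_I:
  assumes "\<And>n. X n \<in> F" "\<And>\<epsilon>. \<epsilon> > 0 \<Longrightarrow> \<exists>N. \<forall>m\<ge>N. \<forall>n\<ge>N. q (X m - X n) < \<epsilon>"
  shows "X \<in> CS"
  using assms by (simp add: cauchy_seqs_def)

lemma CS_const: "a \<in> F \<Longrightarrow> (\<lambda>n. a) \<in> CS"
  by (rule CS_I) auto

lemma CS_q_Cauchy: assumes "X \<in> CS" shows "Cauchy (\<lambda>n. q (X n))"
proof (rule metric_CauchyI)
  fix \<epsilon> :: real assume "\<epsilon> > 0"
  then obtain N where "\<forall>m\<ge>N. \<forall>n\<ge>N. q (X m - X n) < \<epsilon>" using CS_cauchy assms by blast
  then show "\<exists>N. \<forall>m\<ge>N. \<forall>n\<ge>N. dist (q (X m)) (q (X n)) < \<epsilon>"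
    unfolding dist_real_def using q_abs_diff CS_in[OF assms] by (meson le_less_trans)
qed

lemma CS_q_lim: "X \<in> CS \<Longrightarrow> (\<lambda>n. q (X n)) \<longlonglongrightarrow> lim (\<lambda>n. q (X n))"
  using Cauchy_convergent[OF CS_q_Cauchy] by (simp add: convergent_LIMSEQ_iff)

lemma CS_bdd: assumes "X \<in> CS" obtains B where "B > 0" "\<And>n. q (X n) \<le> B"
proof -
  obtain B where "B > 0" "\<forall>n. norm (q (X n)) \<le> B"
    using Cauchy_Bseq[OF CS_q_Cauchy[OF assms]] by (auto simp: Bseq_def)
  then show thesis by (intro that[of B]) (auto simp: abs_le_iff)
qed

lemma CS_add: assumes "X \<in> CS" "Y \<in> CS" shows "(\<lambda>n. X n + Y n) \<in> CS"
proof (rule CS_I)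
  fix \<epsilon> :: real assume "\<epsilon> > 0"
  then obtain N M where N: "\<forall>m\<ge>N. \<forall>n\<ge>N. q (X m - X n) < \<epsilon>/2" "\<forall>m\<ge>M. \<forall>n\<ge>M. q (Y m - Y n) < \<epsilon>/2"
    using CS_cauchy[OF assms(1), of "\<epsilon>/2"] CS_cauchy[OF assms(2), of "\<epsilon>/2"] by auto
  have "q (X m + Y m - (X n + Y n)) < \<epsilon>" if "m \<ge> max N M" "n \<ge> max N M" for m n
  proof -
    have "q ((X m - X n) + (Y m - Y n)) \<le> q (X m - X n) + q (Y m - Y n)"
      by (rule q_triangle) (simp_all add: CS_in assms free_closed)
    also have "\<dots> < \<epsilon>/2 + \<epsilon>/2" using N that by (intro add_strict_mono) auto
    finally show ?thesis by (simp add: algebra_simps)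
  qed
  then show "\<exists>N. \<forall>m\<ge>N. \<forall>n\<ge>N. q (X m + Y m - (X n + Y n)) < \<epsilon>" by blast
qed (simp add: CS_in assms free_closed)

lemma CS_scale: assumes "X \<in> CS" shows "(\<lambda>n. fscale c (X n)) \<in> CS"
proof (rule CS_I)
  fix \<epsilon> :: real assume "\<epsilon> > 0"
  then have "\<epsilon> / (cmod c + 1) > 0" by (simp add: add_nonneg_pos)
  then obtain N where N: "\<forall>m\<ge>N. \<forall>n\<ge>N. q (X m - X n) < \<epsilon> / (cmod c + 1)"
    using CS_cauchy assms by blast
  have "q (fscale c (X m) - fscale c (X n)) < \<epsilon>" if "m \<ge> N" "n \<ge> N" for m n
  proof -
    have "q (fscale c (X m) - fscale c (X n)) = cmod c * q (X m - X n)"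
      using q_scale[of "X m - X n" c] by (simp add: CS_in assms free_closed fscale_add)
    also have "\<dots> \<le> (cmod c + 1) * q (X m - X n)"
      by (intro mult_right_mono q_nonneg) (simp_all add: CS_in assms free_closed)
    also have "\<dots> < \<epsilon>"
      using N that pos_less_divide_eq[of "cmod c + 1" _ \<epsilon>] by (simp add: add_nonneg_pos mult.commute)
    finally show ?thesis .
  qed
  then show "\<exists>N. \<forall>m\<ge>N. \<forall>n\<ge>N. q (fscale c (X m) - fscale c (X n)) < \<epsilon>" by blast
qed (simp add: CS_in assms free_closed)

lemma CS_mult: assumes "X \<in> CS" "Y \<in> CS" shows "(\<lambda>n. X n * Y n) \<in> CS"
proof (rule CS_I)
  fix \<epsilon> :: real assume "\<epsilon> > 0"
  obtain B B' where B: "B > 0" "\<And>n. q (X n) \<le> B" "B' > 0" "\<And>n. q (Y n) \<le> B'"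
    using CS_bdd[OF assms(1)] CS_bdd[OF assms(2)] by metis
  from \<open>\<epsilon> > 0\<close> B have "\<epsilon>/2/B' > 0" "\<epsilon>/2/B > 0" by auto
  then obtain N M where N: "\<forall>m\<ge>N. \<forall>n\<ge>N. q (X m - X n) < \<epsilon>/2/B'" "\<forall>m\<ge>M. \<forall>n\<ge>M. q (Y m - Y n) < \<epsilon>/2/B"
    using CS_cauchy[OF assms(1)] CS_cauchy[OF assms(2)] by blast
  have "q (X m * Y m - X n * Y n) < \<epsilon>" if "m \<ge> max N M" "n \<ge> max N M" for m n
  proof -
    have "q (X m * Y m - X n * Y n) \<le> q (X m) * q (Y m - Y n) + q (X m - X n) * q (Y n)"
      by (rule q_mult_diff) (simp_all add: CS_in assms)
    also have "\<dots> \<le> B * q (Y m - Y n) + q (X m - X n) * B'"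
      by (intro add_mono mult_right_mono mult_left_mono B q_nonneg)
        (simp_all add: CS_in assms free_closed)
    also have "\<dots> < B * (\<epsilon>/2/B) + \<epsilon>/2/B' * B'"
      using N that B by (intro add_strict_mono mult_strict_left_mono mult_strict_right_mono) auto
    finally show ?thesis using B by simp
  qed
  then show "\<exists>N. \<forall>m\<ge>N. \<forall>n\<ge>N. q (X m * Y m - X n * Y n) < \<epsilon>" by blast
qed (simp add: CS_in assms free_closed)

lemma CS_star: assumes "X \<in> CS" shows "(\<lambda>n. fstar (X n)) \<in> CS"
proof (rule CS_I)
  fix \<epsilon> :: real assume "\<epsilon> > 0"
  then show "\<exists>N. \<forall>m\<ge>N. \<forall>n\<ge>N. q (fstar (X m) - fstar (X n)) < \<epsilon>"
    using CS_cauchy[OF assms] q_star CS_in[OF assms] by (simp add: free_closed flip: fstar_minus)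
qed (simp add: CS_in assms free_closed)

lemmas CS_closed = CS_const[OF free_zero] CS_add CS_scale CS_mult CS_star

lemma null_relI: "X \<in> CS \<Longrightarrow> Y \<in> CS \<Longrightarrow> (\<lambda>n. q (X n - Y n)) \<longlonglongrightarrow> 0 \<Longrightarrow> (X, Y) \<in> null_rel \<Gamma> q"
  by (simp add: null_rel_def)

lemma null_relD: "(X, Y) \<in> null_rel \<Gamma> q \<Longrightarrow> X \<in> CS \<and> Y \<in> CS \<and> (\<lambda>n. q (X n - Y n)) \<longlonglongrightarrow> 0"
  by (simp add: null_rel_def)

lemma tendsto0_le:
  fixes f g :: "nat \<Rightarrow> real"
  assumes "g \<longlonglongrightarrow> 0" "\<And>n. 0 \<le> f n" "\<And>n. f n \<le> g n" shows "f \<longlonglongrightarrow> 0"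
  by (rule tendsto_sandwich[OF _ _ tendsto_const assms(1)]) (use assms in auto)

lemma null_rel_equiv: "equiv CS (null_rel \<Gamma> q)"
proof (rule equivI)
  show "null_rel \<Gamma> q \<subseteq> CS \<times> CS" by (auto simp: null_rel_def)
  show "refl_on CS (null_rel \<Gamma> q)" by (auto simp: refl_on_def null_rel_def)
  show "sym (null_rel \<Gamma> q)"
    by (auto simp: sym_def null_rel_def q_diff_commute CS_in)
  show "trans (null_rel \<Gamma> q)"
  proof (rule transI)
    fix X Y Z assume "(X, Y) \<in> null_rel \<Gamma> q" "(Y, Z) \<in> null_rel \<Gamma> q"
    then have *: "X \<in> CS" "Y \<in> CS" "Z \<in> CS" "(\<lambda>n. q (X n - Y n)) \<longlonglongrightarrow> 0" "(\<lambda>n. q (Y n - Z n)) \<longlonglongrightarrow> 0"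
      by (auto simp: null_rel_def)
    have "(\<lambda>n. q (X n - Z n)) \<longlonglongrightarrow> 0"
      by (rule tendsto0_le[where g = "\<lambda>n. q (X n - Y n) + q (Y n - Z n)"])
        (use * tendsto_add[OF *(4,5)] in \<open>auto intro!: q_nonneg q_triangle3 simp: CS_in free_closed\<close>)
    with * show "(X, Z) \<in> null_rel \<Gamma> q" by (simp add: null_rel_def)
  qed
qed

lemma cls_eq_iff: "X \<in> CS \<Longrightarrow> Y \<in> CS \<Longrightarrow> cls X = cls Y \<longleftrightarrow> (\<lambda>n. q (X n - Y n)) \<longlonglongrightarrow> 0"
  using eq_equiv_class_iff[OF null_rel_equiv, of X Y] by (simp add: null_rel_def)

lemma rep_cls: assumes "X \<in> CS" shows "rep (cls X) \<in> CS" "(\<lambda>n. q (rep (cls X) n - X n)) \<longlonglongrightarrow> 0"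
proof -
  have "X \<in> cls X" using equiv_class_self[OF null_rel_equiv assms] .
  then have "rep (cls X) \<in> cls X" unfolding rep_def by (rule someI[where P = "\<lambda>Y. Y \<in> cls X"])
  then have "(X, rep (cls X)) \<in> null_rel \<Gamma> q" by simp
  then have "(rep (cls X), X) \<in> null_rel \<Gamma> q"
    using null_rel_equiv unfolding equiv_def sym_def by blast
  then show "rep (cls X) \<in> CS" "(\<lambda>n. q (rep (cls X) n - X n)) \<longlonglongrightarrow> 0" by (auto simp: null_rel_def)
qed

lemma carr_C: "carr C = CS // null_rel \<Gamma> q" by (simp add: completion_def)

lemma cls_in: "X \<in> CS \<Longrightarrow> cls X \<in> carr C" by (simp add: carr_C quotientI)

lemma carr_cases: assumes "\<xi> \<in> carr C" obtains X where "X \<in> CS" "\<xi> = cls X"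
  using assms by (auto simp: carr_C elim: quotientE)

lemma C_zero: "czero C = cls (\<lambda>n. 0)" by (simp add: completion_def)

lemma C_add: assumes "X \<in> CS" "Y \<in> CS" shows "cadd C (cls X) (cls Y) = cls (\<lambda>n. X n + Y n)"
proof -
  note r = rep_cls[OF assms(1)] rep_cls[OF assms(2)]
  let ?X = "rep (cls X)" and ?Y = "rep (cls Y)"
  have "(\<lambda>n. q (?X n + ?Y n - (X n + Y n))) \<longlonglongrightarrow> 0"
  proof (rule tendsto0_le)
    show "(\<lambda>n. q (?X n - X n) + q (?Y n - Y n)) \<longlonglongrightarrow> 0" using tendsto_add[OF r(2,4)] by simp
    show "q (?X n + ?Y n - (X n + Y n)) \<le> q (?X n - X n) + q (?Y n - Y n)" for n
      using q_triangle[of "?X n - X n" "?Y n - Y n"] r assms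
      by (simp add: CS_in free_closed algebra_simps)
  qed (use r assms in \<open>simp add: q_nonneg CS_in free_closed\<close>)
  then show ?thesis
    by (simp add: completion_def cls_eq_iff CS_closed assms r)
qed

lemma C_scale: assumes "X \<in> CS" shows "cscale C c (cls X) = cls (\<lambda>n. fscale c (X n))"
proof -
  note r = rep_cls[OF assms(1)]
  have "(\<lambda>n. q (fscale c (rep (cls X) n) - fscale c (X n))) \<longlonglongrightarrow> 0"
    using tendsto_mult_left[OF r(2), of "cmod c"] assms r(1)
    by (simp add: q_scale CS_in free_closed flip: fscale_add)
  then show ?thesis by (simp add: completion_def cls_eq_iff CS_closed assms r)
qed

lemma C_mult: assumes "X \<in> CS" "Y \<in> CS" shows "cmult C (cls X) (cls Y) = cls (\<lambda>n. X n * Y n)"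
proof -
  note r = rep_cls[OF assms(1)] rep_cls[OF assms(2)]
  let ?X = "rep (cls X)" and ?Y = "rep (cls Y)"
  have "(\<lambda>n. q (?X n * ?Y n - X n * Y n)) \<longlonglongrightarrow> 0"
  proof (rule tendsto0_le)
    show "(\<lambda>n. q (?X n) * q (?Y n - Y n) + q (?X n - X n) * q (Y n)) \<longlonglongrightarrow> 0"
      using tendsto_add[OF tendsto_mult[OF CS_q_lim[OF r(1)] r(4)] tendsto_mult[OF r(2) CS_q_lim[OF assms(2)]]]
      by simp
    show "q (?X n * ?Y n - X n * Y n) \<le> q (?X n) * q (?Y n - Y n) + q (?X n - X n) * q (Y n)" for n
      by (rule q_mult_diff) (use r assms in \<open>simp_all add: CS_in\<close>)
  qed (use r assms in \<open>simp add: q_nonneg CS_in free_closed\<close>)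
  then show ?thesis
    by (simp add: completion_def cls_eq_iff CS_closed assms r)
qed

lemma C_star: assumes "X \<in> CS" shows "cstar C (cls X) = cls (\<lambda>n. fstar (X n))"
proof -
  note r = rep_cls[OF assms(1)]
  have "(\<lambda>n. q (fstar (rep (cls X) n) - fstar (X n))) \<longlonglongrightarrow> 0"
    using r assms by (simp add: q_star CS_in free_closed flip: fstar_minus)
  then show ?thesis by (simp add: completion_def cls_eq_iff CS_closed assms r)
qed

lemma C_norm: assumes "X \<in> CS" shows "(\<lambda>n. q (X n)) \<longlonglongrightarrow> cnorm C (cls X)"
proof -
  note r = rep_cls[OF assms(1)]
  have "(\<lambda>n. \<bar>q (X n) - q (rep (cls X) n)\<bar>) \<longlonglongrightarrow> 0"
    by (rule tendsto0_le[OF r(2)])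
      (use r assms in \<open>auto intro: q_abs_diff simp: CS_in q_diff_commute[of "rep (cls X) _"]\<close>)
  then have "(\<lambda>n. q (X n) - q (rep (cls X) n)) \<longlonglongrightarrow> 0"
    using tendsto_rabs_zero_iff by blast
  from tendsto_add[OF this CS_q_lim[OF r(1)]] show ?thesis by (simp add: completion_def)
qed

lemma C_norm_eq: "X \<in> CS \<Longrightarrow> (\<lambda>n. q (X n)) \<longlonglongrightarrow> l \<Longrightarrow> cnorm C (cls X) = l"
  using C_norm LIMSEQ_unique by blast

lemma C_dist:
  assumes "X \<in> CS" "Y \<in> CS"
  shows "(\<lambda>n. q (X n - Y n)) \<longlonglongrightarrow> cdist C (cls X) (cls Y)"
  using C_norm[OF CS_add[OF assms(1) CS_scale[OF assms(2), of "-1"]]] assms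
  by (simp add: cdist_def C_scale C_add CS_scale) (simp add: fscale_minus1)

lemma C_dense:
  assumes "\<xi> \<in> carr C" "\<epsilon> > 0"
  obtains a where "a \<in> F" "cdist C \<xi> (cls (\<lambda>n. a)) < \<epsilon>"
proof -
  obtain X where X: "X \<in> CS" "\<xi> = cls X" using assms(1) by (rule carr_cases)
  obtain N where N: "\<forall>m\<ge>N. \<forall>n\<ge>N. q (X m - X n) < \<epsilon>/2" using CS_cauchy[OF X(1), of "\<epsilon>/2"] assms(2) by auto
  have "cdist C \<xi> (cls (\<lambda>n. X N)) \<le> \<epsilon>/2"
    unfolding X(2) by (rule LIMSEQ_le_const2[OF C_dist])
      (use X N in \<open>auto intro: CS_const CS_in less_imp_le\<close>)
  then show thesis using that[of "X N"] assms X CS_in by fastforce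
qed

lemma C_complete:
  assumes Z: "\<And>n. Z n \<in> carr C"
    and cau: "\<And>\<epsilon>. \<epsilon> > 0 \<Longrightarrow> \<exists>N. \<forall>m\<ge>N. \<forall>n\<ge>N. cdist C (Z m) (Z n) < \<epsilon>"
  shows "\<exists>\<zeta> \<in> carr C. (\<lambda>n. cdist C (Z n) \<zeta>) \<longlonglongrightarrow> 0"
proof -
  have "\<forall>n. \<exists>a. a \<in> F \<and> cdist C (Z n) (cls (\<lambda>k. a)) < inverse (real (Suc n))"
  proof
    fix n show "\<exists>a. a \<in> F \<and> cdist C (Z n) (cls (\<lambda>k. a)) < inverse (real (Suc n))"
      by (rule C_dense[OF Z[of n], of "inverse (real (Suc n))"]) auto
  qed
  then obtain a where a: "\<And>n. a n \<in> F" "\<And>n. cdist C (Z n) (cls (\<lambda>k. a n)) < inverse (real (Suc n))"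
    by metis
  have dist_const: "cdist C (cls (\<lambda>k. a m)) (cls (\<lambda>k. a n)) = q (a m - a n)" for m n
    using C_dist[of "\<lambda>k. a m" "\<lambda>k. a n"] a by (simp add: CS_const LIMSEQ_const_iff)
  have tri: "cdist C \<xi> \<zeta> \<le> cdist C \<xi> \<eta> + cdist C \<eta> \<zeta>"
    if "\<xi> \<in> carr C" "\<eta> \<in> carr C" "\<zeta> \<in> carr C" for \<xi> \<eta> \<zeta>
  proof -
    from that(1) obtain X where X: "X \<in> CS" "\<xi> = cls X" by (rule carr_cases)
    from that(2) obtain Y where Y: "Y \<in> CS" "\<eta> = cls Y" by (rule carr_cases)
    from that(3) obtain W where W: "W \<in> CS" "\<zeta> = cls W" by (rule carr_cases)
    show ?thesis unfolding X(2) Y(2) W(2)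
      by (rule LIMSEQ_le[OF C_dist tendsto_add[OF C_dist C_dist]])
        (use X Y W in \<open>auto intro: q_triangle3 CS_in\<close>)
  qed
  have sym: "cdist C \<xi> \<eta> = cdist C \<eta> \<xi>" if "\<xi> \<in> carr C" "\<eta> \<in> carr C" for \<xi> \<eta>
  proof -
    from that(1) obtain X where X: "X \<in> CS" "\<xi> = cls X" by (rule carr_cases)
    from that(2) obtain Y where Y: "Y \<in> CS" "\<eta> = cls Y" by (rule carr_cases)
    have eq: "(\<lambda>n. q (X n - Y n)) = (\<lambda>n. q (Y n - X n))"
      using X(1) Y(1) by (intro ext q_diff_commute CS_in)
    show ?thesis unfolding X(2) Y(2)
      by (rule LIMSEQ_unique[OF C_dist[OF X(1) Y(1)] C_dist[OF Y(1) X(1), folded eq]])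
  qed
  have inv: "\<exists>N. \<forall>n\<ge>N. inverse (real (Suc n)) < \<epsilon>" if "\<epsilon> > 0" for \<epsilon>
    using that LIMSEQ_inverse_real_of_nat[unfolded LIMSEQ_def] by (auto simp: dist_real_def)
  have aCS: "a \<in> CS"
  proof (rule CS_I)
    fix \<epsilon> :: real assume "\<epsilon> > 0"
    obtain N where N: "\<forall>m\<ge>N. \<forall>n\<ge>N. cdist C (Z m) (Z n) < \<epsilon>/3" using cau[of "\<epsilon>/3"] \<open>\<epsilon> > 0\<close> by auto
    obtain M where M: "\<forall>n\<ge>M. inverse (real (Suc n)) < \<epsilon>/3" using inv[of "\<epsilon>/3"] \<open>\<epsilon> > 0\<close> by auto
    have "q (a m - a n) < \<epsilon>" if mn: "m \<ge> max N M" "n \<ge> max N M" for m n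
    proof -
      have c: "cls (\<lambda>k. a i) \<in> carr C" for i using a by (intro cls_in CS_const)
      have "q (a m - a n) \<le> cdist C (Z m) (cls (\<lambda>k. a m)) + (cdist C (Z m) (Z n) + cdist C (Z n) (cls (\<lambda>k. a n)))"
        using tri[OF c[of m] Z[of m] c[of n]] tri[OF Z[of m] Z[of n] c[of n]] sym[OF Z[of m] c[of m]]
        by (simp add: dist_const)
      also have "\<dots> < \<epsilon>/3 + (\<epsilon>/3 + \<epsilon>/3)"
        using N M mn a(2)[of m] a(2)[of n] by (intro add_strict_mono) (auto intro: less_trans)
      finally show ?thesis by simp
    qed
    then show "\<exists>N. \<forall>m\<ge>N. \<forall>n\<ge>N. q (a m - a n) < \<epsilon>" by blast
  qed (rule a)
  have "(\<lambda>n. cdist C (Z n) (cls a)) \<longlonglongrightarrow> 0"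
  proof (rule metric_LIMSEQ_I)
    fix \<epsilon> :: real assume "\<epsilon> > 0"
    obtain N where N: "\<forall>m\<ge>N. \<forall>n\<ge>N. q (a m - a n) < \<epsilon>/3" using CS_cauchy[OF aCS, of "\<epsilon>/3"] \<open>\<epsilon> > 0\<close> by auto
    obtain M where M: "\<forall>n\<ge>M. inverse (real (Suc n)) < \<epsilon>/3" using inv[of "\<epsilon>/3"] \<open>\<epsilon> > 0\<close> by auto
    have "cdist C (Z n) (cls a) < \<epsilon>" if n: "n \<ge> max N M" for n
    proof -
      have c: "cls (\<lambda>k. a n) \<in> carr C" using a by (intro cls_in CS_const)
      have "cdist C (cls (\<lambda>k. a n)) (cls a) \<le> \<epsilon>/3"
        by (rule LIMSEQ_le_const2[OF C_dist]) (use aCS N n a in \<open>auto intro: CS_const less_imp_le\<close>)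
      moreover have "cdist C (Z n) (cls (\<lambda>k. a n)) < \<epsilon>/3" using a(2)[of n] M n by (auto intro: less_trans)
      ultimately show ?thesis using tri[OF Z[of n] c cls_in[OF aCS]] \<open>\<epsilon> > 0\<close> by simp
    qed
    moreover have "cdist C (Z n) (cls a) \<ge> 0" for n
    proof -
      obtain X where X: "X \<in> CS" "Z n = cls X" using Z[of n] by (rule carr_cases)
      show ?thesis unfolding X(2)
        by (rule LIMSEQ_le_const[OF C_dist]) (use X aCS in \<open>auto intro!: q_nonneg simp: CS_in free_closed\<close>)
    qed
    ultimately have "\<forall>n\<ge>max N M. dist (cdist C (Z n) (cls a)) 0 < \<epsilon>"
      by (simp add: dist_real_def)
    then show "\<exists>N. \<forall>n\<ge>N. dist (cdist C (Z n) (cls a)) 0 < \<epsilon>" by blast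
  qed
  with cls_in[OF aCS] show ?thesis by blast
qed

theorem cstar_algebra_completion: "cstar_algebra C"
proof
  fix Z :: "nat \<Rightarrow> (nat \<Rightarrow> 'g free_alg) set"
  assume "\<And>n. Z n \<in> carr C" "\<And>\<epsilon>. \<epsilon> > 0 \<Longrightarrow> \<exists>N. \<forall>m\<ge>N. \<forall>n\<ge>N. cdist C (Z m) (Z n) < \<epsilon>"
  then show "\<exists>\<zeta> \<in> carr C. (\<lambda>n. cdist C (Z n) \<zeta>) \<longlonglongrightarrow> 0" by (rule C_complete)
next
  fix a b assume *: "a \<in> carr C" "b \<in> carr C"
  from *(1) obtain X where X: "X \<in> CS" "a = cls X" by (rule carr_cases)
  from *(2) obtain Y where Y: "Y \<in> CS" "b = cls Y" by (rule carr_cases)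
  show "cnorm C (cadd C a b) \<le> cnorm C a + cnorm C b"
    unfolding X(2) Y(2) C_add[OF X(1) Y(1)]
    by (rule LIMSEQ_le[OF C_norm tendsto_add[OF C_norm C_norm]])
      (use X Y in \<open>auto intro: q_triangle CS_closed CS_in\<close>)
  show "cnorm C (cmult C a b) \<le> cnorm C a * cnorm C b"
    unfolding X(2) Y(2) C_mult[OF X(1) Y(1)]
    by (rule LIMSEQ_le[OF C_norm tendsto_mult[OF C_norm C_norm]])
      (use X Y in \<open>auto intro: q_mult CS_closed CS_in\<close>)
next
  fix a assume "a \<in> carr C"
  then obtain X where X: "X \<in> CS" "a = cls X" by (rule carr_cases)
  show "cnorm C a = 0 \<longleftrightarrow> a = czero C"
  proof -
    have "cls X = cls (\<lambda>n. 0) \<longleftrightarrow> (\<lambda>n. q (X n)) \<longlonglongrightarrow> 0"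
      using cls_eq_iff[of X "\<lambda>n. 0"] X by (simp add: CS_closed)
    also have "\<dots> \<longleftrightarrow> cnorm C (cls X) = 0"
    proof
      show "cnorm C (cls X) = 0" if "(\<lambda>n. q (X n)) \<longlonglongrightarrow> 0" by (rule C_norm_eq[OF X(1) that])
      show "(\<lambda>n. q (X n)) \<longlonglongrightarrow> 0" if "cnorm C (cls X) = 0" using C_norm[OF X(1)] that by simp
    qed
    finally show ?thesis by (simp add: X C_zero)
  qed
  show "cnorm C (cscale C c a) = cmod c * cnorm C a" for c
    using C_norm_eq[OF CS_scale[OF X(1), of c]] tendsto_mult_left[OF C_norm[OF X(1)], of "cmod c"] X
    by (simp add: C_scale q_scale CS_in)
  show "cnorm C (cmult C (cstar C a) a) = (cnorm C a)\<^sup>2"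
    using C_norm_eq[OF CS_mult[OF CS_star[OF X(1)] X(1)]] tendsto_power[OF C_norm[OF X(1)], of 2] X
    by (simp add: C_star C_mult CS_closed q_star_mult CS_in)
next
  show "czero C \<in> carr C" by (simp add: C_zero cls_in CS_closed)
next
  fix a b d assume *: "a \<in> carr C" "b \<in> carr C" "d \<in> carr C"
  from *(1) obtain X where X: "X \<in> CS" "a = cls X" by (rule carr_cases)
  from *(2) obtain Y where Y: "Y \<in> CS" "b = cls Y" by (rule carr_cases)
  from *(3) obtain Z where Z: "Z \<in> CS" "d = cls Z" by (rule carr_cases)
  note ops = X(2) Y(2) Z(2) C_zero C_add C_scale C_mult C_star CS_closed cls_in X(1) Y(1) Z(1)
  show "cadd C (cadd C a b) d = cadd C a (cadd C b d)" by (simp add: ops add.assoc)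
  show "cmult C (cmult C a b) d = cmult C a (cmult C b d)" by (simp add: ops mult.assoc)
  show "cmult C (cadd C a b) d = cadd C (cmult C a d) (cmult C b d)" by (simp add: ops distrib_right)
  show "cmult C d (cadd C a b) = cadd C (cmult C d a) (cmult C d b)" by (simp add: ops distrib_left)
next
  fix a b c assume *: "a \<in> carr C" "b \<in> carr C"
  from *(1) obtain X where X: "X \<in> CS" "a = cls X" by (rule carr_cases)
  from *(2) obtain Y where Y: "Y \<in> CS" "b = cls Y" by (rule carr_cases)
  note ops = X(2) Y(2) C_zero C_add C_scale C_mult C_star CS_closed cls_in X(1) Y(1)
  show "cadd C a b \<in> carr C" "cmult C a b \<in> carr C" by (simp_all add: ops)
  show "cadd C a b = cadd C b a" by (simp add: ops add.commute)
  show "cscale C c (cadd C a b) = cadd C (cscale C c a) (cscale C c b)" by (simp add: ops fscale_add)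
  show "cmult C (cscale C c a) b = cscale C c (cmult C a b)"
    "cmult C a (cscale C c b) = cscale C c (cmult C a b)" by (simp_all add: ops fscale_mult)
  show "cstar C (cadd C a b) = cadd C (cstar C a) (cstar C b)" by (simp add: ops fstar_add)
  show "cstar C (cmult C a b) = cmult C (cstar C b) (cstar C a)" by (simp add: ops fstar_mult)
next
  fix a c c' assume "a \<in> carr C"
  then obtain X where X: "X \<in> CS" "a = cls X" by (rule carr_cases)
  note ops = X(2) C_zero C_add C_scale C_mult C_star CS_closed cls_in X(1)
  show "cscale C c a \<in> carr C" "cstar C a \<in> carr C" by (simp_all add: ops)
  show "cadd C a (czero C) = a" by (simp add: ops)
  show "cadd C a (cscale C (-1) a) = czero C" by (simp add: ops) (simp add: fscale_minus1)
  show "cscale C (c + c') a = cadd C (cscale C c a) (cscale C c' a)" by (simp add: ops fscale_add)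
  show "cscale C c (cscale C c' a) = cscale C (c * c') a" by (simp add: ops fscale_fscale)
  show "cscale C 1 a = a" by (simp add: ops)
  show "cstar C (cstar C a) = a" by (simp add: ops)
  show "cstar C (cscale C c a) = cscale C (cnj c) (cstar C a)" by (simp add: ops fstar_fscale)
qed

end


definition relation_seminorms :: "'g set \<Rightarrow> 'g free_alg set \<Rightarrow> ('g free_alg \<Rightarrow> real) set" where
  "relation_seminorms \<Gamma> R = {q. cstar_seminorm \<Gamma> q \<and> (\<forall>r \<in> R. q r = 0)}"

lemma univ_norm_alt: "univ_norm \<Gamma> R a = (SUP q \<in> relation_seminorms \<Gamma> R. q a)"
  by (simp add: univ_norm_def relation_seminorms_def)

lemma zero_relation_seminorm: "(\<lambda>a. 0) \<in> relation_seminorms \<Gamma> R"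
  by (simp add: relation_seminorms_def cstar_seminorm_def)

lemma univ_norm_relator: assumes "r \<in> R" shows "univ_norm \<Gamma> R r = 0"
proof -
  have "(\<lambda>q. q r) ` relation_seminorms \<Gamma> R = {0}"
    using assms zero_relation_seminorm[of \<Gamma> R] by (force simp: relation_seminorms_def)
  then show ?thesis by (simp add: univ_norm_alt)
qed

lemma univ_norm_seminorm:
  assumes bdd: "\<And>a. a \<in> free_star_alg \<Gamma> \<Longrightarrow> bdd_above ((\<lambda>q. q a) ` relation_seminorms \<Gamma> R)"
  shows "cstar_seminorm \<Gamma> (univ_norm \<Gamma> R)"
proof -
  let ?Q = "relation_seminorms \<Gamma> R" and ?F = "free_star_alg \<Gamma>" and ?N = "univ_norm \<Gamma> R"
  have ne: "?Q \<noteq> {}" using zero_relation_seminorm by blast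
  have sem: "cstar_seminormed \<Gamma> q" if "q \<in> ?Q" for q
    using that by (simp add: relation_seminorms_def cstar_seminormed_def)
  have up: "q a \<le> ?N a" if "a \<in> ?F" "q \<in> ?Q" for q a
    unfolding univ_norm_alt by (rule cSUP_upper[OF that(2) bdd[OF that(1)]])
  have least: "?N a \<le> B" if "\<And>q. q \<in> ?Q \<Longrightarrow> q a \<le> B" for a B
    unfolding univ_norm_alt by (rule cSUP_least[OF ne that])
  have nonneg: "0 \<le> ?N a" if "a \<in> ?F" for a
    using up[OF that zero_relation_seminorm] .
  show ?thesis
    unfolding cstar_seminorm_def
  proof (intro conjI ballI allI)
    fix a b assume ab: "a \<in> ?F" "b \<in> ?F"
    show "?N (a + b) \<le> ?N a + ?N b"
    proof (rule least)
      fix q assume q: "q \<in> ?Q"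
      have "q (a + b) \<le> q a + q b" by (rule cstar_seminormed.q_triangle[OF sem[OF q] ab])
      also have "\<dots> \<le> ?N a + ?N b" by (intro add_mono up ab q)
      finally show "q (a + b) \<le> ?N a + ?N b" .
    qed
    show "?N (a * b) \<le> ?N a * ?N b"
    proof (rule least)
      fix q assume q: "q \<in> ?Q"
      have "q (a * b) \<le> q a * q b" by (rule cstar_seminormed.q_mult[OF sem[OF q] ab])
      also have "\<dots> \<le> ?N a * ?N b"
        by (intro mult_mono up ab q nonneg cstar_seminormed.q_nonneg[OF sem[OF q]])
      finally show "q (a * b) \<le> ?N a * ?N b" .
    qed
  next
    fix a c assume a: "a \<in> ?F"
    have le: "?N (fscale d b) \<le> cmod d * ?N b" if "b \<in> ?F" for d b
    proof (rule least)
      fix q assume q: "q \<in> ?Q"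
      show "q (fscale d b) \<le> cmod d * ?N b"
        using cstar_seminormed.q_scale[OF sem[OF q] that] up[OF that q] by (simp add: mult_left_mono)
    qed
    show "?N (fscale c a) = cmod c * ?N a"
    proof (cases "c = 0")
      case True
      then show ?thesis using le[OF a, of c] nonneg[OF free_fscale[OF a, of c]] by simp
    next
      case False
      have "?N a \<le> cmod (inverse c) * ?N (fscale c a)"
        using le[OF free_fscale[OF a, of c], of "inverse c"] False by (simp add: fscale_fscale)
      then have "cmod c * ?N a \<le> cmod c * (cmod (inverse c) * ?N (fscale c a))"
        by (rule mult_left_mono) simp
      then have "cmod c * ?N a \<le> ?N (fscale c a)"
        using False by (simp flip: mult.assoc norm_mult)
      then show ?thesis using le[OF a, of c] by simp
    qed
  next
    fix a assume a: "a \<in> ?F"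
    then have a2: "fstar a * a \<in> ?F" by (simp add: free_closed)
    show "?N (fstar a * a) = (?N a)\<^sup>2"
    proof (rule antisym)
      show "?N (fstar a * a) \<le> (?N a)\<^sup>2"
      proof (rule least)
        fix q assume q: "q \<in> ?Q"
        show "q (fstar a * a) \<le> (?N a)\<^sup>2"
          using cstar_seminormed.q_star_mult[OF sem[OF q] a] up[OF a q]
            cstar_seminormed.q_nonneg[OF sem[OF q] a] by (simp add: power_mono)
      qed
      have "?N a \<le> sqrt (?N (fstar a * a))"
      proof (rule least)
        fix q assume q: "q \<in> ?Q"
        have "(q a)\<^sup>2 \<le> ?N (fstar a * a)"
          using cstar_seminormed.q_star_mult[OF sem[OF q] a] up[OF a2 q] by simp
        then show "q a \<le> sqrt (?N (fstar a * a))" by (rule real_le_rsqrt)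
      qed
      then have "(?N a)\<^sup>2 \<le> (sqrt (?N (fstar a * a)))\<^sup>2" using nonneg[OF a] by (rule power_mono)
      then show "(?N a)\<^sup>2 \<le> ?N (fstar a * a)" using nonneg[OF a2] by simp
    qed
  qed
qed


section \<open>Graph algebras\<close>

text \<open>Graphs are digraphs in the sense of \<open>Graph_Theory\<close>: source is \<open>tail\<close> and range is \<open>head\<close>.\<close>

definition regular_vertex :: "('v, 'e) pre_digraph \<Rightarrow> 'v \<Rightarrow> bool" where
  "regular_vertex E u \<longleftrightarrow> u \<in> verts E \<and> out_arcs E u \<noteq> {} \<and> finite (out_arcs E u)"

datatype ('v, 'e) ck_gen = Vtx 'v | Edg 'e

definition ck_gens :: "('v, 'e) pre_digraph \<Rightarrow> ('v, 'e) ck_gen set" where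
  "ck_gens E = Vtx ` verts E \<union> Edg ` arcs E"

abbreviation vproj :: "'v \<Rightarrow> ('v, 'e) ck_gen free_alg" where
  "vproj u \<equiv> gen (Vtx u)"

abbreviation eiso :: "'e \<Rightarrow> ('v, 'e) ck_gen free_alg" where
  "eiso g \<equiv> gen (Edg g)"

abbreviation erange :: "'e \<Rightarrow> ('v, 'e) ck_gen free_alg" where
  "erange g \<equiv> eiso g * fstar (eiso g)"

text \<open>
  The order relation \<open>erange g \<le> vproj u\<close> between projections is expressed as
  \<open>vproj u * erange g = erange g\<close>.
\<close>

definition CK_relators :: "('v, 'e) pre_digraph \<Rightarrow> ('v, 'e) ck_gen free_alg set" where
  "CK_relators E =
     {fstar (vproj u) - vproj u | u. u \<in> verts E} \<union>
     {vproj u * vproj u - vproj u | u. u \<in> verts E} \<union>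
     {vproj u * vproj u' | u u'. u \<in> verts E \<and> u' \<in> verts E \<and> u \<noteq> u'} \<union>
     {eiso g * fstar (eiso g) * eiso g - eiso g | g. g \<in> arcs E} \<union>
     {erange g * erange h | g h. g \<in> arcs E \<and> h \<in> arcs E \<and> g \<noteq> h} \<union>
     {fstar (eiso g) * eiso g - vproj (head E g) | g. g \<in> arcs E} \<union>
     {vproj (tail E g) * erange g - erange g | g. g \<in> arcs E} \<union>
     {vproj u - (\<Sum>g \<in> out_arcs E u. erange g) | u. regular_vertex E u}"

definition graph_cstar ::
  "('v, 'e) pre_digraph \<Rightarrow> (nat \<Rightarrow> ('v, 'e) ck_gen free_alg) set cstar_alg" where
  "graph_cstar E = universal_cstar (ck_gens E) (CK_relators E)"

definition graph_embed ::
  "('v, 'e) pre_digraph \<Rightarrow> ('v, 'e) ck_gen free_alg \<Rightarrow> (nat \<Rightarrow> ('v, 'e) ck_gen free_alg) set" where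
  "graph_embed E = univ_embed (ck_gens E) (CK_relators E)"

lemma CK_seminorm_bdd:
  assumes E: "wf_digraph E" and hq: "q \<in> relation_seminorms (ck_gens E) (CK_relators E)"
    and a: "a \<in> free_star_alg (ck_gens E)"
  shows "q a \<le> (\<Sum>w \<in> Poly_Mapping.keys a. cmod (Poly_Mapping.lookup a w))"
proof -
  interpret cstar_seminormed "ck_gens E" q
    using hq by (simp add: relation_seminorms_def cstar_seminormed_def)
  have rel: "q r = 0" if "r \<in> CK_relators E" for r
    using that hq by (simp add: relation_seminorms_def)
  have Vin: "vproj u \<in> F" if "u \<in> verts E" for u using that by (simp add: ck_gens_def free_gen)
  have Ein: "eiso g \<in> F" if "g \<in> arcs E" for g using that by (simp add: ck_gens_def free_gen)
  have V: "q (vproj u) \<le> 1" if u: "u \<in> verts E" for u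
  proof -
    let ?p = "vproj u"
    have p: "?p \<in> F" by (rule Vin[OF u])
    have 1: "q (fstar ?p - ?p) = 0" "q (?p * ?p - ?p) = 0"
      using u by (auto intro!: rel simp: CK_relators_def)
    have "q (fstar ?p * ?p - ?p) \<le> q ((fstar ?p - ?p) * ?p) + q (?p * ?p - ?p)"
      using q_triangle[of "(fstar ?p - ?p) * ?p" "?p * ?p - ?p"] p
      by (simp add: free_closed left_diff_distrib)
    also have "\<dots> \<le> q (fstar ?p - ?p) * q ?p + q (?p * ?p - ?p)"
      using p by (intro add_right_mono q_mult) (simp_all add: free_closed)
    also have "\<dots> = 0" by (simp add: 1)
    finally have "\<bar>q (fstar ?p * ?p) - q ?p\<bar> \<le> 0"
      using q_abs_diff[of "fstar ?p * ?p" ?p] p by (simp add: free_closed)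
    then have "q ?p * q ?p = q ?p" using q_star_mult[OF p] by (simp add: power2_eq_square)
    then show ?thesis by auto
  qed
  have S: "q (eiso g) \<le> 1" if g: "g \<in> arcs E" for g
  proof -
    have h: "head E g \<in> verts E" using E g by (rule wf_digraph.head_in_verts)
    have "q (fstar (eiso g) * eiso g - vproj (head E g)) = 0"
      using g by (intro rel) (auto simp: CK_relators_def)
    then have "\<bar>q (fstar (eiso g) * eiso g) - q (vproj (head E g))\<bar> \<le> 0"
      using q_abs_diff[of "fstar (eiso g) * eiso g" "vproj (head E g)"] Ein[OF g] Vin[OF h]
      by (simp add: free_closed)
    then have "(q (eiso g))\<^sup>2 \<le> 1" using V[OF h] q_star_mult[OF Ein[OF g]] by simp
    then show ?thesis by (simp add: abs_square_le_1)
  qed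
  have G: "q (gen x) \<le> 1" if "x \<in> ck_gens E" for x
    using that V S by (auto simp: ck_gens_def)
  have L: "Poly_Mapping.single (Word [x]) 1 \<in> F \<and> q (Poly_Mapping.single (Word [x]) 1) \<le> 1"
    if "base x \<in> ck_gens E" for x
  proof (cases x)
    case (Gen y)
    with that G[of y] free_gen[of y] show ?thesis by (simp add: gen_def)
  next
    case (Adj y)
    have "Poly_Mapping.single (Word [x]) 1 = fstar (gen y)"
      by (simp add: gen_def fstar_single adj_word_def Adj)
    then show ?thesis using that Adj G[of y] free_gen[of y] by (simp add: free_closed q_star)
  qed
  have W: "Poly_Mapping.single (Word l) 1 \<in> F \<and> q (Poly_Mapping.single (Word l) 1) \<le> 1"
    if "l \<noteq> []" "base ` set l \<subseteq> ck_gens E" for l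
    using that
  proof (induction l rule: list_nonempty_induct)
    case (single x) then show ?case using L by simp
  next
    case (cons x l)
    let ?x = "Poly_Mapping.single (Word [x]) (1::complex)" and ?l = "Poly_Mapping.single (Word l) (1::complex)"
    have eq: "Poly_Mapping.single (Word (x # l)) 1 = ?x * ?l"
      by (simp add: mult_single plus_fword_def)
    have *: "?x \<in> F" "q ?x \<le> 1" "?l \<in> F" "q ?l \<le> 1" using cons L[of x] by auto
    have "q (?x * ?l) \<le> q ?x * q ?l" by (rule q_mult) (use * in auto)
    also have "\<dots> \<le> 1" using * by (intro mult_le_one q_nonneg) auto
    finally show ?case unfolding eq using * by (simp add: free_closed)
  qed
  have K: "Poly_Mapping.single w c \<in> F \<and> q (Poly_Mapping.single w c) \<le> cmod c"
    if "w \<in> Poly_Mapping.keys a" for w c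
  proof -
    have *: "Poly_Mapping.single w 1 \<in> F \<and> q (Poly_Mapping.single w 1) \<le> 1"
      using W[of "letters w"] a that by (auto simp: free_star_alg_def)
    have eq: "Poly_Mapping.single w c = fscale c (Poly_Mapping.single w 1)" by (simp add: fscale_single)
    show ?thesis unfolding eq using * q_nonneg
      by (simp add: q_scale free_closed mult_left_le)
  qed
  have "q (\<Sum>w \<in> M. Poly_Mapping.single w (Poly_Mapping.lookup a w))
      \<le> (\<Sum>w \<in> M. cmod (Poly_Mapping.lookup a w))"
    if "finite M" "M \<subseteq> Poly_Mapping.keys a" for M
    using that
  proof induction
    case (insert w M)
    have "q (Poly_Mapping.single w (Poly_Mapping.lookup a w) +
            (\<Sum>w \<in> M. Poly_Mapping.single w (Poly_Mapping.lookup a w)))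
        \<le> q (Poly_Mapping.single w (Poly_Mapping.lookup a w)) +
            q (\<Sum>w \<in> M. Poly_Mapping.single w (Poly_Mapping.lookup a w))"
      using insert.prems by (intro q_triangle free_sum) (use K in auto)
    with insert K[of w "Poly_Mapping.lookup a w"] show ?case by simp
  qed simp
  from this[of "Poly_Mapping.keys a"] show ?thesis
    by (simp flip: free_alg_eq_sum)
qed

lemma graph_seminormed:
  assumes "wf_digraph E"
  shows "cstar_seminormed (ck_gens E) (univ_norm (ck_gens E) (CK_relators E))"
  unfolding cstar_seminormed_def
  by (rule univ_norm_seminorm) (auto intro!: bdd_aboveI2 CK_seminorm_bdd[OF assms])

theorem graph_cstar_algebra:
  assumes "wf_digraph E" shows "cstar_algebra (graph_cstar E)"
  unfolding graph_cstar_def universal_cstar_def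
  by (rule cstar_seminormed.cstar_algebra_completion[OF graph_seminormed[OF assms]])

lemma graph_embed_hom:
  assumes "wf_digraph E" "a \<in> free_star_alg (ck_gens E)" "b \<in> free_star_alg (ck_gens E)"
  shows "graph_embed E a \<in> carr (graph_cstar E)"
    and "graph_embed E (a + b) = cadd (graph_cstar E) (graph_embed E a) (graph_embed E b)"
    and "graph_embed E (fscale c a) = cscale (graph_cstar E) c (graph_embed E a)"
    and "graph_embed E (a * b) = cmult (graph_cstar E) (graph_embed E a) (graph_embed E b)"
    and "graph_embed E (fstar a) = cstar (graph_cstar E) (graph_embed E a)"
proof -
  interpret cstar_seminormed "ck_gens E" "univ_norm (ck_gens E) (CK_relators E)"
    by (rule graph_seminormed[OF assms(1)])
  note * = graph_cstar_def universal_cstar_def graph_embed_def univ_embed_def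
  show "graph_embed E a \<in> carr (graph_cstar E)"
    using assms unfolding * by (intro cls_in CS_const)
  show "graph_embed E (a + b) = cadd (graph_cstar E) (graph_embed E a) (graph_embed E b)"
    unfolding * by (rule C_add[symmetric]) (use assms in \<open>auto intro: CS_const\<close>)
  show "graph_embed E (fscale c a) = cscale (graph_cstar E) c (graph_embed E a)"
    unfolding * by (rule C_scale[symmetric]) (use assms in \<open>auto intro: CS_const\<close>)
  show "graph_embed E (a * b) = cmult (graph_cstar E) (graph_embed E a) (graph_embed E b)"
    unfolding * by (rule C_mult[symmetric]) (use assms in \<open>auto intro: CS_const\<close>)
  show "graph_embed E (fstar a) = cstar (graph_cstar E) (graph_embed E a)"
    unfolding * by (rule C_star[symmetric]) (use assms in \<open>auto intro: CS_const\<close>)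
qed

lemma CK_relators_free:
  assumes "wf_digraph E" shows "CK_relators E \<subseteq> free_star_alg (ck_gens E)"
proof -
  have "vproj u \<in> free_star_alg (ck_gens E)" if "u \<in> verts E" for u
    using that by (simp add: ck_gens_def free_gen)
  moreover have "eiso g \<in> free_star_alg (ck_gens E)" if "g \<in> arcs E" for g
    using that by (simp add: ck_gens_def free_gen)
  ultimately show ?thesis
    using wf_digraph.head_in_verts[OF assms] wf_digraph.tail_in_verts[OF assms]
    by (auto simp: CK_relators_def regular_vertex_def out_arcs_def
        intro!: free_mult free_minus free_fstar free_sum)
qed

lemma graph_embed_relator:
  assumes "wf_digraph E" "r \<in> CK_relators E"
  shows "graph_embed E r = czero (graph_cstar E)"
proof -
  interpret cstar_seminormed "ck_gens E" "univ_norm (ck_gens E) (CK_relators E)"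
    by (rule graph_seminormed[OF assms(1)])
  have "r \<in> F" using CK_relators_free assms by blast
  then show ?thesis
    by (simp add: graph_cstar_def universal_cstar_def graph_embed_def univ_embed_def C_zero
        cls_eq_iff CS_const free_zero univ_norm_relator assms(2))
qed


section \<open>Admissible pairs and their ideals\<close>

definition hereditary :: "('v, 'e) pre_digraph \<Rightarrow> 'v set \<Rightarrow> bool" where
  "hereditary E H \<longleftrightarrow> H \<subseteq> verts E \<and> (\<forall>g \<in> arcs E. tail E g \<in> H \<longrightarrow> head E g \<in> H)"

definition saturated :: "('v, 'e) pre_digraph \<Rightarrow> 'v set \<Rightarrow> bool" where
  "saturated E H \<longleftrightarrow> (\<forall>u. regular_vertex E u \<and> head E ` out_arcs E u \<subseteq> H \<longrightarrow> u \<in> H)"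

definition arcs_outside :: "('v, 'e) pre_digraph \<Rightarrow> 'v set \<Rightarrow> 'v \<Rightarrow> 'e set" where
  "arcs_outside E H u = {g \<in> out_arcs E u. head E g \<notin> H}"

definition breaking_vertices :: "('v, 'e) pre_digraph \<Rightarrow> 'v set \<Rightarrow> 'v set" where
  "breaking_vertices E H = {u \<in> verts E. infinite (out_arcs E u) \<and>
     arcs_outside E H u \<noteq> {} \<and> finite (arcs_outside E H u)}"

definition admissible_pair :: "('v, 'e) pre_digraph \<Rightarrow> 'v set \<Rightarrow> 'v set \<Rightarrow> bool" where
  "admissible_pair E H S \<longleftrightarrow> hereditary E H \<and> saturated E H \<and> S \<subseteq> breaking_vertices E H"

definition gap_proj :: "('v, 'e) pre_digraph \<Rightarrow> 'v set \<Rightarrow> 'v \<Rightarrow> ('v, 'e) ck_gen free_alg" where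
  "gap_proj E H u = vproj u - (\<Sum>g \<in> arcs_outside E H u. erange g)"

definition pair_ideal ::
  "('v, 'e) pre_digraph \<Rightarrow> 'v set \<Rightarrow> 'v set \<Rightarrow> (nat \<Rightarrow> ('v, 'e) ck_gen free_alg) set set" where
  "pair_ideal E H S = ideal_generated (graph_cstar E)
     ({graph_embed E (vproj u) | u. u \<in> H} \<union> {graph_embed E (gap_proj E H u) | u. u \<in> S})"

definition pair_ideal_cstar ::
  "('v, 'e) pre_digraph \<Rightarrow> 'v set \<Rightarrow> 'v set \<Rightarrow> (nat \<Rightarrow> ('v, 'e) ck_gen free_alg) set cstar_alg" where
  "pair_ideal_cstar E H S = (graph_cstar E)\<lparr>carr := pair_ideal E H S\<rparr>"


section \<open>The Deicke--Hong--Szymanski graph of an admissible pair\<close>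

definition entry_paths :: "('v, 'e) pre_digraph \<Rightarrow> 'v set \<Rightarrow> 'v set \<Rightarrow> 'e list set" where
  "entry_paths E H S = {\<alpha>. \<alpha> \<noteq> [] \<and> (\<exists>u z. pre_digraph.awalk E u \<alpha> z \<and> u \<notin> H \<and> z \<in> H \<union> S) \<and>
     (\<forall>g \<in> set (butlast \<alpha>). head E g \<notin> H \<union> S)}"

definition new_paths :: "('v, 'e) pre_digraph \<Rightarrow> 'v set \<Rightarrow> 'v set \<Rightarrow> 'e list set" where
  "new_paths E H S = entry_paths E H S - {[g] | g. g \<in> arcs E \<and> tail E g \<in> S \<and> head E g \<in> H}"

text \<open>
  A path in \<open>new_paths E H S\<close> occurs both as a vertex \<open>Inr \<alpha>\<close> and as the edge \<open>Inr \<alpha>\<close> (the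
  copy written with a bar in the literature); the old vertices and edges are tagged with \<open>Inl\<close>.
  The construction is meant for \<open>H \<noteq> {}\<close>. The union \<open>H \<union> S\<close> is automatically disjoint, since
  all edges leaving a vertex of a hereditary \<open>H\<close> end in \<open>H\<close>.
\<close>

definition DHS_graph ::
  "('v, 'e) pre_digraph \<Rightarrow> 'v set \<Rightarrow> 'v set \<Rightarrow> ('v + 'e list, 'e + 'e list) pre_digraph" where
  "DHS_graph E H S =
    \<lparr> verts = Inl ` (H \<union> S) \<union> Inr ` new_paths E H S,
      arcs = Inl ` {g \<in> arcs E. tail E g \<in> H} \<union>
             Inl ` {g \<in> arcs E. tail E g \<in> S \<and> head E g \<in> H} \<union>
             Inr ` new_paths E H S,
      tail = (\<lambda>x. case x of Inl g \<Rightarrow> Inl (tail E g) | Inr \<alpha> \<Rightarrow> Inr \<alpha>),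
      head = (\<lambda>x. case x of Inl g \<Rightarrow> Inl (head E g) | Inr \<alpha> \<Rightarrow> Inl (head E (last \<alpha>))) \<rparr>"

lemma wf_DHS_graph:
  assumes "hereditary E H" shows "wf_digraph (DHS_graph E H S)"
proof -
  have cas_last: "head E (last p) = z" if "pre_digraph.cas E u p z" "p \<noteq> []" for p u z
    using that by (induction p arbitrary: u) (auto simp: pre_digraph.cas.simps split: if_splits)
  have last_in: "head E (last \<alpha>) \<in> H \<union> S" if \<alpha>: "\<alpha> \<in> new_paths E H S" for \<alpha>
  proof -
    from \<alpha> obtain u z where "\<alpha> \<noteq> []" "pre_digraph.awalk E u \<alpha> z" "z \<in> H \<union> S"
      by (auto simp: new_paths_def entry_paths_def)
    then show ?thesis using cas_last by (metis pre_digraph.awalk_def)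
  qed
  show ?thesis
  proof
    fix g assume "g \<in> arcs (DHS_graph E H S)"
    then show "tail (DHS_graph E H S) g \<in> verts (DHS_graph E H S)"
      by (auto simp: DHS_graph_def)
    show "head (DHS_graph E H S) g \<in> verts (DHS_graph E H S)"
      using \<open>g \<in> arcs (DHS_graph E H S)\<close> assms last_in
      by (auto simp: DHS_graph_def hereditary_def)
  qed
qed

end

theory Submission
  imports Defs
begin

text \<open>
  The algebra of the Deicke--Hong--Szymanski graph has a unit, because all paths entering
  \<open>{v, w, x}\<close> have length one and the graph therefore has only five vertices. The ideal has no
  unit: modulo the ideal generated by the projection at \<open>x\<close> it consists of compact operators in the
  Toeplitz-type representation of the two-cycle on the basis vectors \<open>\<delta>\<^sub>0, \<delta>\<^sub>1, \<dots>\<close>, where \<open>e\<close> and \<open>f\<close>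
  act as shifts and the gap projection at \<open>v\<close> is the projection onto \<open>\<delta>\<^sub>0\<close>. A compact operator maps
  \<open>\<delta>\<^sub>n\<close> to vectors tending to \<open>0\<close>, but a unit would have to fix every \<open>\<delta>\<^sub>n\<close>.
\<close>


section \<open>Finitely supported functions as an inner product space\<close>

text \<open>For complex coefficients this is the real part of the usual Hermitian product. The real
  structure already supplies Cauchy-Schwarz and operator norms; complex scalars come in separately
  through \<open>cscl\<close>.\<close>

instantiation poly_mapping :: (type, real_inner) real_inner
begin

definition scaleR_poly_mapping :: "real \<Rightarrow> ('a \<Rightarrow>\<^sub>0 'b) \<Rightarrow> ('a \<Rightarrow>\<^sub>0 'b)"
  where "r *\<^sub>R f = Poly_Mapping.map ((*\<^sub>R) r) f"

definition inner_poly_mapping :: "('a \<Rightarrow>\<^sub>0 'b) \<Rightarrow> ('a \<Rightarrow>\<^sub>0 'b) \<Rightarrow> real"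
  where "f \<bullet> g = (\<Sum>i\<in>Poly_Mapping.keys f. Poly_Mapping.lookup f i \<bullet> Poly_Mapping.lookup g i)"

definition norm_poly_mapping :: "('a \<Rightarrow>\<^sub>0 'b) \<Rightarrow> real"
  where "norm (f :: 'a \<Rightarrow>\<^sub>0 'b) = sqrt (f \<bullet> f)"

definition sgn_poly_mapping :: "('a \<Rightarrow>\<^sub>0 'b) \<Rightarrow> ('a \<Rightarrow>\<^sub>0 'b)"
  where "sgn (f :: 'a \<Rightarrow>\<^sub>0 'b) = inverse (norm f) *\<^sub>R f"

definition dist_poly_mapping :: "('a \<Rightarrow>\<^sub>0 'b) \<Rightarrow> ('a \<Rightarrow>\<^sub>0 'b) \<Rightarrow> real"
  where "dist (f :: 'a \<Rightarrow>\<^sub>0 'b) g = norm (f - g)"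

definition uniformity_poly_mapping :: "(('a \<Rightarrow>\<^sub>0 'b) \<times> ('a \<Rightarrow>\<^sub>0 'b)) filter"
  where "uniformity = (INF e\<in>{0<..}. principal {(f :: 'a \<Rightarrow>\<^sub>0 'b, g). dist f g < e})"

definition open_poly_mapping :: "('a \<Rightarrow>\<^sub>0 'b) set \<Rightarrow> bool"
  where "open (U :: ('a \<Rightarrow>\<^sub>0 'b) set) = (\<forall>f\<in>U. \<forall>\<^sub>F (f', g) in uniformity. f' = f \<longrightarrow> g \<in> U)"

lemma lookup_scaleR [simp]: "Poly_Mapping.lookup (r *\<^sub>R f) i = r *\<^sub>R Poly_Mapping.lookup f i"
  by (simp add: scaleR_poly_mapping_def Poly_Mapping.map.rep_eq when_def)

text \<open>Lets sums over different supports be compared over one common finite index set.\<close>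

lemma inner_poly_mapping_superset:
  assumes "finite K" "Poly_Mapping.keys f \<subseteq> K"
  shows "f \<bullet> g = (\<Sum>i\<in>K. Poly_Mapping.lookup f i \<bullet> Poly_Mapping.lookup g i)"
  unfolding inner_poly_mapping_def using assms
  by (intro sum.mono_neutral_left) (auto simp: in_keys_iff)

instance
proof
  fix f g h :: "'a \<Rightarrow>\<^sub>0 'b" and r s :: real
  let ?K = "Poly_Mapping.keys f \<union> Poly_Mapping.keys g"
  show "r *\<^sub>R (f + g) = r *\<^sub>R f + r *\<^sub>R g" "(r + s) *\<^sub>R f = r *\<^sub>R f + s *\<^sub>R f"
    "r *\<^sub>R s *\<^sub>R f = (r * s) *\<^sub>R f" "1 *\<^sub>R f = f"
    by (rule poly_mapping_eqI, simp add: lookup_add scaleR_add_right scaleR_add_left)+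
  show "sgn f = inverse (norm f) *\<^sub>R f" "dist f g = norm (f - g)" "norm f = sqrt (f \<bullet> f)"
    by (simp_all add: sgn_poly_mapping_def dist_poly_mapping_def norm_poly_mapping_def)
  show "uniformity = (INF e\<in>{0<..}. principal {(f :: 'a \<Rightarrow>\<^sub>0 'b, g). dist f g < e})"
    by (simp add: uniformity_poly_mapping_def)
  show "open U = (\<forall>f\<in>U. \<forall>\<^sub>F (f', g) in uniformity. f' = f \<longrightarrow> g \<in> U)" for U :: "('a \<Rightarrow>\<^sub>0 'b) set"
    by (simp add: open_poly_mapping_def)
  show "f \<bullet> g = g \<bullet> f"
    using inner_poly_mapping_superset[of ?K f g] inner_poly_mapping_superset[of ?K g f]
    by (simp add: inner_commute)
  show "(f + g) \<bullet> h = f \<bullet> h + g \<bullet> h"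
    using inner_poly_mapping_superset[of ?K "f + g" h] inner_poly_mapping_superset[of ?K f h]
      inner_poly_mapping_superset[of ?K g h] Poly_Mapping.keys_add[of f g]
    by (simp add: lookup_add inner_add_left sum.distrib)
  show "(r *\<^sub>R f) \<bullet> g = r * (f \<bullet> g)"
    using inner_poly_mapping_superset[of "Poly_Mapping.keys f" "r *\<^sub>R f" g]
    by (simp add: inner_poly_mapping_def sum_distrib_left subset_iff in_keys_iff)
  show "0 \<le> f \<bullet> f" by (simp add: inner_poly_mapping_def sum_nonneg)
  show "f \<bullet> f = 0 \<longleftrightarrow> f = 0"
  proof
    assume "f \<bullet> f = 0"
    then have "\<forall>i\<in>Poly_Mapping.keys f. Poly_Mapping.lookup f i \<bullet> Poly_Mapping.lookup f i = 0"
      by (subst (asm) inner_poly_mapping_def) (simp add: sum_nonneg_eq_0_iff)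
    then have "Poly_Mapping.keys f = {}" by (auto simp del: keys_eq_empty simp: in_keys_iff)
    then show "f = 0" by (simp only: keys_eq_empty)
  qed (simp add: inner_poly_mapping_def)
qed

end

lemma inner_single_right: "f \<bullet> Poly_Mapping.single i z = Poly_Mapping.lookup f i \<bullet> z"
  using inner_poly_mapping_superset[of "insert i (Poly_Mapping.keys f)" f "Poly_Mapping.single i z"]
  by (auto simp: lookup_single when_def if_distrib sum.delta' subset_insertI cong: if_cong)

lemma norm_single_poly_mapping: "norm (Poly_Mapping.single i z :: _ \<Rightarrow>\<^sub>0 'b::real_inner) = norm z"
  by (simp add: norm_eq_sqrt_inner inner_single_right)

text \<open>Complex multiplication on a space whose class instance has real scalars only; its
  adjoint for the real inner product is \<open>cscl (cnj c)\<close>.\<close>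

definition cscl :: "complex \<Rightarrow> ('k \<Rightarrow>\<^sub>0 complex) \<Rightarrow> ('k \<Rightarrow>\<^sub>0 complex)" where
  "cscl c f = Poly_Mapping.map ((*) c) f"

lemma lookup_cscl [simp]: "Poly_Mapping.lookup (cscl c f) i = c * Poly_Mapping.lookup f i"
  by (simp add: cscl_def Poly_Mapping.map.rep_eq when_def)

lemma cscl_algebra:
  "cscl c (f + g) = cscl c f + cscl c g" "cscl (c + d) f = cscl c f + cscl d f"
  "cscl c (cscl d f) = cscl (c * d) f" "cscl 1 f = f" "cscl 0 f = 0" "cscl c 0 = 0"
  "cscl c (r *\<^sub>R f) = r *\<^sub>R cscl c f"
  by (rule poly_mapping_eqI, simp add: lookup_add algebra_simps)+

lemma inner_cscl: "cscl c f \<bullet> g = f \<bullet> cscl (cnj c) g"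
proof -
  have "cscl c f \<bullet> g
      = (\<Sum>i\<in>Poly_Mapping.keys f. Poly_Mapping.lookup (cscl c f) i \<bullet> Poly_Mapping.lookup g i)"
    by (rule inner_poly_mapping_superset) (auto simp: in_keys_iff)
  also have "\<dots> = f \<bullet> cscl (cnj c) g"
    unfolding inner_poly_mapping_def by (rule sum.cong) (simp_all add: inner_complex_def algebra_simps)
  finally show ?thesis .
qed

lemma norm_cscl: "norm (cscl c f) = cmod c * norm f"
proof -
  have "cscl (cnj c * c) f = (cmod c)\<^sup>2 *\<^sub>R f"
    by (rule poly_mapping_eqI)
      (simp add: scaleR_conv_of_real mult.commute[of "cnj c"] complex_norm_square[symmetric])
  then have "cscl c f \<bullet> cscl c f = (cmod c)\<^sup>2 * (f \<bullet> f)"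
    by (simp add: inner_cscl[of c] cscl_algebra(3) inner_commute)
  then show ?thesis by (simp add: norm_eq_sqrt_inner real_sqrt_mult)
qed

lemma bounded_linear_cscl: "bounded_linear (cscl c)"
  by (rule bounded_linear_intro[where K = "cmod c"])
    (simp_all add: cscl_algebra norm_cscl mult.commute)


section \<open>Representations of the free *-algebra on finitely supported functions\<close>

text \<open>
  Only a pre-Hilbert space is needed: once every generator has an everywhere defined adjoint, the
  operator norm satisfies the C*-identity without completeness.
\<close>

locale free_rep =
  fixes A :: "'g letter \<Rightarrow> ('k \<Rightarrow>\<^sub>0 complex) \<Rightarrow> ('k \<Rightarrow>\<^sub>0 complex)"
  assumes bounded: "bounded_linear (A l)"
    and cscl_commute: "A l (cscl c f) = cscl c (A l f)"
    and adjoint: "A l f \<bullet> g = f \<bullet> A (adj_letter l) g"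
begin

definition word_op :: "'g fword \<Rightarrow> ('k \<Rightarrow>\<^sub>0 complex) \<Rightarrow> ('k \<Rightarrow>\<^sub>0 complex)" where
  "word_op u f = foldr A (letters u) f"

text \<open>Defined on the whole unital ring: the empty word acts as the identity, so constants act
  as complex scalars.\<close>

definition op :: "'g free_alg \<Rightarrow> ('k \<Rightarrow>\<^sub>0 complex) \<Rightarrow> ('k \<Rightarrow>\<^sub>0 complex)" where
  "op a f = (\<Sum>u\<in>Poly_Mapping.keys a. cscl (Poly_Mapping.lookup a u) (word_op u f))"

lemma word_op_add: "word_op (u + u') f = word_op u (word_op u' f)"
  by (simp add: word_op_def plus_fword_def)

lemma bounded_word_op: "bounded_linear (word_op u)"
proof -
  have "bounded_linear (\<lambda>f. foldr A ls f)" for ls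
    by (induction ls) (auto intro: bounded_linear_compose[OF bounded])
  then show ?thesis by (simp add: word_op_def[abs_def])
qed

lemma word_op_cscl: "word_op u (cscl c f) = cscl c (word_op u f)"
proof -
  have "foldr A ls (cscl c f) = cscl c (foldr A ls f)" for ls
    by (induction ls) (auto simp: cscl_commute)
  then show ?thesis by (simp add: word_op_def)
qed

lemma word_op_adjoint: "word_op u f \<bullet> g = f \<bullet> word_op (adj_word u) g"
proof -
  have "foldr A ls f \<bullet> g = f \<bullet> foldr A (rev (map adj_letter ls)) g" for ls
    by (induction ls arbitrary: g) (simp_all add: adjoint)
  then show ?thesis by (simp add: word_op_def adj_word_def)
qed

lemma bounded_op: "bounded_linear (op a)"
  unfolding op_def[abs_def]
  by (intro bounded_linear_sum bounded_linear_compose[OF bounded_linear_cscl] bounded_word_op)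

lemma op_superset:
  assumes "finite K" "Poly_Mapping.keys a \<subseteq> K"
  shows "op a f = (\<Sum>u\<in>K. cscl (Poly_Mapping.lookup a u) (word_op u f))"
  unfolding op_def using assms
  by (intro sum.mono_neutral_left) (auto simp: in_keys_iff cscl_algebra)

lemma op_zero [simp]: "op 0 f = 0"
  by (simp add: op_def)

lemma op_add: "op (a + b) f = op a f + op b f"
proof -
  let ?K = "Poly_Mapping.keys a \<union> Poly_Mapping.keys b"
  show ?thesis
    using op_superset[of ?K "a + b" f] op_superset[of ?K a f] op_superset[of ?K b f]
      Poly_Mapping.keys_add[of a b]
    by (simp add: lookup_add cscl_algebra sum.distrib)
qed

lemma op_single: "op (Poly_Mapping.single u c) f = cscl c (word_op u f)"
  using op_superset[of "{u}" "Poly_Mapping.single u c" f] by (simp add: lookup_single)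

lemma op_linear: "op a (f + g) = op a f + op a g" "op a 0 = 0"
  using linear_add[of "op a" f g] linear_0[of "op a"] bounded_op[of a]
  by (auto simp: bounded_linear_def linear_conv_bounded_linear dest: bounded_linear.linear)

text \<open>By bilinearity it suffices to treat two single words, where concatenation becomes
  composition.\<close>

lemma op_mult: "op (a * b) f = op a (op b f)"
proof (induction a rule: free_alg_induct)
  case (add u c a)
  have "op (Poly_Mapping.single u c * b) f = op (Poly_Mapping.single u c) (op b f)"
  proof (induction b rule: free_alg_induct)
    case (add u' d b)
    then show ?case
      by (simp add: distrib_left op_add op_linear mult_single op_single word_op_add word_op_cscl
          cscl_algebra)
  qed (simp add: op_linear)
  with add show ?case by (simp add: distrib_right op_add)
qed simp

lemma op_fscale: "op (fscale c a) f = cscl c (op a f)"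
  by (simp add: fscale_def op_mult op_single) (simp add: word_op_def zero_fword_def)

lemma op_minus: "op (a - b) f = op a f - op b f"
  using op_add[of "a - b" b f] by simp

lemma op_gen: "op (gen x) = A (Gen x)" "op (fstar (gen x)) = A (Adj x)"
  by (rule ext, simp add: gen_def fstar_single op_single word_op_def adj_word_def cscl_algebra)+

lemma op_adjoint: "op a f \<bullet> g = f \<bullet> op (fstar a) g"
proof (induction a rule: free_alg_induct)
  case (add u c a)
  have "op (Poly_Mapping.single u c) f \<bullet> g = f \<bullet> op (fstar (Poly_Mapping.single u c)) g"
    by (simp add: op_single fstar_single inner_cscl word_op_adjoint word_op_cscl)
  with add show ?case by (simp add: op_add fstar_add inner_add_left inner_add_right)
qed simp

lemma norm_op_le: "norm (op a f) \<le> onorm (op a) * norm f"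
  by (rule onorm[OF bounded_op])

lemma onorm_op_le: "0 \<le> B \<Longrightarrow> (\<And>f. norm (op a f) \<le> B * norm f) \<Longrightarrow> onorm (op a) \<le> B"
  by (rule onorm_bound)

lemma onorm_op_nonneg: "0 \<le> onorm (op a)"
  by (rule onorm_pos_le[OF bounded_op])

lemma onorm_op_mult: "onorm (op (a * b)) \<le> onorm (op a) * onorm (op b)"
  using onorm_compose[OF bounded_op bounded_op, of a b] by (simp add: comp_def flip: op_mult)

text \<open>The half of the C*-identity that uses adjoints: the squared norm of
  \<open>op a f\<close> is the inner product of \<open>f\<close> with
  \<open>op (fstar a * a) f\<close>, which Cauchy-Schwarz bounds.\<close>

lemma onorm_op_sq_le: "(onorm (op a))\<^sup>2 \<le> onorm (op (fstar a * a))"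
proof -
  have "norm (op a f) \<le> sqrt (onorm (op (fstar a * a))) * norm f" for f
  proof (rule power2_le_imp_le)
    have "(norm (op a f))\<^sup>2 = f \<bullet> op (fstar a * a) f"
      by (simp add: power2_norm_eq_inner op_adjoint op_mult)
    also have "\<dots> \<le> norm f * norm (op (fstar a * a) f)" by (rule norm_cauchy_schwarz)
    also have "\<dots> \<le> norm f * (onorm (op (fstar a * a)) * norm f)"
      by (intro mult_left_mono norm_op_le) simp
    also have "\<dots> = (sqrt (onorm (op (fstar a * a))) * norm f)\<^sup>2"
      by (simp add: power_mult_distrib onorm_op_nonneg) (simp add: power2_eq_square)
    finally show "(norm (op a f))\<^sup>2 \<le> (sqrt (onorm (op (fstar a * a))) * norm f)\<^sup>2" .
  qed (simp add: onorm_op_nonneg)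
  then have "onorm (op a) \<le> sqrt (onorm (op (fstar a * a)))"
    by (intro onorm_op_le) (simp_all add: onorm_op_nonneg)
  then have "(onorm (op a))\<^sup>2 \<le> (sqrt (onorm (op (fstar a * a))))\<^sup>2"
    by (rule power_mono) (rule onorm_op_nonneg)
  then show ?thesis by (simp add: onorm_op_nonneg)
qed

text \<open>Cancel one factor \<open>onorm (op (fstar a))\<close> after combining the preceding
  estimate for \<open>fstar a\<close> with submultiplicativity.\<close>

lemma onorm_op_fstar: "onorm (op (fstar a)) \<le> onorm (op a)"
proof (cases "onorm (op (fstar a)) = 0")
  case False
  have "onorm (op (fstar a)) * onorm (op (fstar a)) \<le> onorm (op a) * onorm (op (fstar a))"
    using onorm_op_sq_le[of "fstar a"] onorm_op_mult[of a "fstar a"] by (simp add: power2_eq_square)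
  with False onorm_op_nonneg[of "fstar a"] show ?thesis by (simp add: mult_le_cancel_right)
qed (simp add: onorm_op_nonneg)

lemma onorm_op_fscale_le: "onorm (op (fscale c a)) \<le> cmod c * onorm (op a)"
  by (rule onorm_op_le)
    (simp_all add: op_fscale norm_cscl mult.assoc mult_left_mono norm_op_le onorm_op_nonneg)

text \<open>Makes every such representation a competitor in the supremum that defines
  \<open>univ_norm\<close>, as soon as it kills the relators.\<close>

theorem cstar_seminorm_onorm: "cstar_seminorm \<Gamma> (\<lambda>a. onorm (op a))"
  unfolding cstar_seminorm_def
proof (intro conjI ballI allI)
  fix a b c
  show "onorm (op (a + b)) \<le> onorm (op a) + onorm (op b)"
    using onorm_triangle[OF bounded_op bounded_op, of a b] by (simp flip: op_add)
  show "onorm (op (a * b)) \<le> onorm (op a) * onorm (op b)" by (rule onorm_op_mult)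
  show "onorm (op (fscale c a)) = cmod c * onorm (op a)"
  proof (rule antisym[OF onorm_op_fscale_le])
    show "cmod c * onorm (op a) \<le> onorm (op (fscale c a))"
    proof (cases "c = 0")
      case False
      \<comment> \<open>The reverse inequality is the proved one, applied to
        \<open>inverse c\<close> and \<open>fscale c a\<close>.\<close>
      then have "onorm (op a) \<le> cmod (inverse c) * onorm (op (fscale c a))"
        using onorm_op_fscale_le[of "inverse c" "fscale c a"] by (simp add: fscale_fscale)
      with False show ?thesis by (simp add: norm_divide field_simps)
    qed (simp add: onorm_op_nonneg)
  qed
  show "onorm (op (fstar a * a)) = (onorm (op a))\<^sup>2"
  proof (rule antisym[OF _ onorm_op_sq_le])
    have "onorm (op (fstar a * a)) \<le> onorm (op (fstar a)) * onorm (op a)" by (rule onorm_op_mult)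
    also have "\<dots> \<le> onorm (op a) * onorm (op a)"
      by (intro mult_right_mono onorm_op_fstar onorm_op_nonneg)
    finally show "onorm (op (fstar a * a)) \<le> (onorm (op a))\<^sup>2" by (simp add: power2_eq_square)
  qed
qed

end


section \<open>Left units and closed ideals\<close>

text \<open>The preimage of the unit works: injectivity cancels \<phi> from the equation between
  images, and \<open>closed\<close> puts the product into the domain of that injectivity.\<close>

lemma left_unit_transfer:
  assumes \<phi>: "star_hom A B \<phi>" "bij_betw \<phi> (carr A) (carr B)"
    and closed: "\<And>a b. a \<in> carr A \<Longrightarrow> b \<in> carr A \<Longrightarrow> cmult A a b \<in> carr A"
    and u: "u \<in> carr B" "\<And>b. b \<in> carr B \<Longrightarrow> cmult B u b = b"
  obtains u' where "u' \<in> carr A" "\<And>a. a \<in> carr A \<Longrightarrow> cmult A u' a = a"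
proof -
  obtain u' where u': "u' \<in> carr A" "\<phi> u' = u" using bij_betw_imp_surj_on[OF \<phi>(2)] u(1) by (metis imageE)
  show thesis
  proof (rule that[OF u'(1)])
    fix a assume a: "a \<in> carr A"
    then have "\<phi> a \<in> carr B" using \<phi>(2) by (auto simp: bij_betw_def)
    then have "\<phi> (cmult A u' a) = \<phi> a" using \<phi>(1) u u' a by (simp add: star_hom_def)
    then show "cmult A u' a = a"
      using \<phi>(2) closed[OF u'(1) a] a by (auto simp: bij_betw_def dest: inj_onD)
  qed
qed

section \<open>The kernel of a C*-seminorm and closed ideals of its completion\<close>

context cstar_seminormed
begin

text \<open>The elements that become zero in the completion. They form a two-sided *-ideal, so
  identities modulo the relators can be computed in the free algebra.\<close>

definition null_elems :: "'g free_alg set" where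
  "null_elems = {a \<in> F. q a = 0}"

lemma null_elemsD: "a \<in> null_elems \<Longrightarrow> a \<in> F" "a \<in> null_elems \<Longrightarrow> q a = 0"
  by (auto simp: null_elems_def)

lemma null_elems_add: "a \<in> null_elems \<Longrightarrow> b \<in> null_elems \<Longrightarrow> a + b \<in> null_elems"
  using q_triangle[of a b] q_nonneg[of "a + b"] by (auto simp: null_elems_def free_closed)

lemma null_elems_uminus: "a \<in> null_elems \<Longrightarrow> - a \<in> null_elems"
  by (auto simp: null_elems_def free_closed q_uminus)

lemma null_elems_mult:
  assumes "a \<in> null_elems" "b \<in> F"
  shows "a * b \<in> null_elems" "b * a \<in> null_elems"
  using assms q_mult[of a b] q_mult[of b a] q_nonneg[of "a * b"] q_nonneg[of "b * a"]
  by (auto simp: null_elems_def free_closed)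

lemma null_elems_fscale: "a \<in> null_elems \<Longrightarrow> fscale c a \<in> null_elems"
  by (auto simp: null_elems_def free_closed q_scale)

lemma null_elems_fstar: "a \<in> null_elems \<Longrightarrow> fstar a \<in> null_elems"
  by (auto simp: null_elems_def free_closed q_star)

lemma null_elems_sum: "(\<And>i. i \<in> K \<Longrightarrow> h i \<in> null_elems) \<Longrightarrow> sum h K \<in> null_elems"
  by (induction K rule: infinite_finite_induct)
    (simp_all add: null_elems_add, simp_all add: null_elems_def free_zero)

text \<open>For \<open>J\<close> inside the free *-algebra this is the closure of its image in the
  completion. Only some representing sequence has to lie in \<open>J\<close>.\<close>

definition ideal_closure :: "'g free_alg set \<Rightarrow> (nat \<Rightarrow> 'g free_alg) set set" where
  "ideal_closure J = {cls X | X. X \<in> CS \<and> (\<forall>n. X n \<in> J)}"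

lemma ideal_closure_cases:
  assumes "\<xi> \<in> ideal_closure J"
  obtains X where "X \<in> CS" "\<And>n. X n \<in> J" "\<xi> = cls X"
  using assms by (auto simp: ideal_closure_def)

lemma ideal_closureI: "X \<in> CS \<Longrightarrow> (\<And>n. X n \<in> J) \<Longrightarrow> cls X \<in> ideal_closure J"
  by (auto simp: ideal_closure_def)

text \<open>Used to exchange a representing sequence for one whose terms lie in a prescribed
  set.\<close>

lemma CS_near:
  assumes Y: "Y \<in> CS" and Z: "\<And>n. Z n \<in> F" and near: "(\<lambda>n. q (Z n - Y n)) \<longlonglongrightarrow> 0"
  shows "Z \<in> CS" "cls Z = cls Y"
proof -
  show Z_CS: "Z \<in> CS"
  proof (rule CS_I[OF Z])
    fix \<epsilon> :: real assume "\<epsilon> > 0"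
    then have "\<forall>\<^sub>F n in sequentially. q (Z n - Y n) < \<epsilon>/3"
      by (intro order_tendstoD(2)[OF near]) simp
    then obtain M where M: "\<And>n. n \<ge> M \<Longrightarrow> q (Z n - Y n) < \<epsilon>/3"
      by (auto simp: eventually_sequentially)
    obtain N where N: "\<forall>m\<ge>N. \<forall>n\<ge>N. q (Y m - Y n) < \<epsilon>/3"
      using CS_cauchy[OF Y, of "\<epsilon>/3"] \<open>\<epsilon> > 0\<close> by auto
    have "q (Z m - Z n) < \<epsilon>" if "m \<ge> max M N" "n \<ge> max M N" for m n
    proof -
      have "q (Z m - Z n) \<le> q (Z m - Y m) + (q (Y m - Y n) + q (Z n - Y n))"
        using q_triangle3[OF Z[of m] CS_in[OF Y, of m] Z[of n]]
          q_triangle3[OF CS_in[OF Y, of m] CS_in[OF Y, of n] Z[of n]]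
          q_diff_commute[OF Z[of n] CS_in[OF Y, of n]] by simp
      also have "\<dots> < \<epsilon>/3 + (\<epsilon>/3 + \<epsilon>/3)" using M N that by (intro add_strict_mono) auto
      finally show ?thesis by simp
    qed
    then show "\<exists>N. \<forall>m\<ge>N. \<forall>n\<ge>N. q (Z m - Z n) < \<epsilon>" by blast
  qed
  show "cls Z = cls Y" using near by (simp add: cls_eq_iff Z_CS Y)
qed

text \<open>A diagonal argument: from the sequences representing the approximants, pick elements of
  \<open>J\<close> that approach the terms of a sequence representing the limit.\<close>

lemma ideal_closure_closed:
  assumes J: "J \<subseteq> F" and \<Xi>: "\<And>k. \<Xi> k \<in> ideal_closure J" and \<xi>: "\<xi> \<in> carr C"
    and lim: "(\<lambda>k. cdist C (\<Xi> k) \<xi>) \<longlonglongrightarrow> 0"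
  shows "\<xi> \<in> ideal_closure J"
proof -
  obtain Y where Y: "Y \<in> CS" "\<xi> = cls Y" using \<xi> by (rule carr_cases)
  \<comment> \<open>The index \<open>n\<close> may have to be large for the approximation;
    \<open>n \<ge> m\<close> makes the Cauchy property bring \<open>Y n\<close> back to
    \<open>Y m\<close>.\<close>
  have "\<exists>z n. z \<in> J \<and> n \<ge> m \<and> q (z - Y n) < inverse (real (Suc m))" for m
  proof -
    have "\<forall>\<^sub>F k in sequentially. cdist C (\<Xi> k) \<xi> < inverse (real (Suc m))"
      by (rule order_tendstoD(2)[OF lim]) simp
    then obtain k where k: "cdist C (\<Xi> k) \<xi> < inverse (real (Suc m))"
      by (auto simp: eventually_sequentially)
    obtain X where X: "X \<in> CS" "\<And>n. X n \<in> J" "\<Xi> k = cls X"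
      using \<Xi>[of k] by (rule ideal_closure_cases) blast
    have "\<forall>\<^sub>F n in sequentially. q (X n - Y n) < inverse (real (Suc m))"
      by (rule order_tendstoD(2)[OF C_dist[OF X(1) Y(1)]]) (use k X Y in simp)
    then obtain N where N: "\<And>n. n \<ge> N \<Longrightarrow> q (X n - Y n) < inverse (real (Suc m))"
      by (auto simp: eventually_sequentially)
    with X(2) show ?thesis by (intro exI[of _ "X (max m N)"] exI[of _ "max m N"]) simp
  qed
  then obtain Z \<nu> where Z: "\<And>m. Z m \<in> J" "\<And>m. \<nu> m \<ge> m"
      "\<And>m. q (Z m - Y (\<nu> m)) < inverse (real (Suc m))"
    by metis
  have ZF: "Z m \<in> F" for m using Z(1) J by auto
  have "(\<lambda>m. q (Y (\<nu> m) - Y m)) \<longlonglongrightarrow> 0"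
  proof (rule metric_LIMSEQ_I)
    fix \<epsilon> :: real assume "\<epsilon> > 0"
    then obtain N where "\<forall>m\<ge>N. \<forall>n\<ge>N. q (Y m - Y n) < \<epsilon>" using CS_cauchy[OF Y(1)] by blast
    then have "q (Y (\<nu> m) - Y m) < \<epsilon>" if "m \<ge> N" for m
      using that Z(2)[of m] by simp
    then have "\<forall>m\<ge>N. dist (q (Y (\<nu> m) - Y m)) 0 < \<epsilon>"
      using q_nonneg[OF free_minus[OF CS_in[OF Y(1)] CS_in[OF Y(1)]]] by (simp add: dist_real_def)
    then show "\<exists>N. \<forall>m\<ge>N. dist (q (Y (\<nu> m) - Y m)) 0 < \<epsilon>" by blast
  qed
  from tendsto_add[OF LIMSEQ_inverse_real_of_nat this]
  have "(\<lambda>m. inverse (real (Suc m)) + q (Y (\<nu> m) - Y m)) \<longlonglongrightarrow> 0" by simp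
  then have "(\<lambda>m. q (Z m - Y m)) \<longlonglongrightarrow> 0"
  proof (rule tendsto0_le)
    fix m
    show "0 \<le> q (Z m - Y m)" by (intro q_nonneg free_minus ZF CS_in[OF Y(1)])
    show "q (Z m - Y m) \<le> inverse (real (Suc m)) + q (Y (\<nu> m) - Y m)"
      using q_triangle3[OF ZF[of m] CS_in[OF Y(1), of "\<nu> m"] CS_in[OF Y(1), of m]] Z(3)[of m]
      by simp
  qed
  from CS_near[OF Y(1) ZF this] Y(2) Z(1) show ?thesis by (metis ideal_closureI)
qed

text \<open>The algebraic conditions hold termwise on representatives; closedness is the diagonal
  argument above.\<close>

lemma closed_ideal_closure:
  assumes J: "J \<subseteq> F" "0 \<in> J"
    and add: "\<And>a b. a \<in> J \<Longrightarrow> b \<in> J \<Longrightarrow> a + b \<in> J"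
    and scale: "\<And>c a. a \<in> J \<Longrightarrow> fscale c a \<in> J"
    and mult: "\<And>a b. a \<in> J \<Longrightarrow> b \<in> F \<Longrightarrow> a * b \<in> J" "\<And>a b. a \<in> J \<Longrightarrow> b \<in> F \<Longrightarrow> b * a \<in> J"
  shows "closed_ideal C (ideal_closure J)"
  unfolding closed_ideal_def
proof (intro conjI ballI allI impI)
  show "ideal_closure J \<subseteq> carr C" by (auto simp: ideal_closure_def intro: cls_in)
  show "czero C \<in> ideal_closure J"
    unfolding C_zero by (rule ideal_closureI) (simp_all add: CS_closed J)
next
  fix \<xi> \<eta> assume "\<xi> \<in> ideal_closure J" "\<eta> \<in> ideal_closure J"
  then show "cadd C \<xi> \<eta> \<in> ideal_closure J"
    by (elim ideal_closure_cases) (auto simp: C_add intro!: ideal_closureI CS_add add)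
next
  fix \<xi> c assume "\<xi> \<in> ideal_closure J"
  then show "cscale C c \<xi> \<in> ideal_closure J"
    by (elim ideal_closure_cases) (auto simp: C_scale intro!: ideal_closureI CS_scale scale)
next
  fix \<xi> \<eta> assume \<xi>: "\<xi> \<in> ideal_closure J" and \<eta>: "\<eta> \<in> carr C"
  obtain X where X: "X \<in> CS" "\<And>n. X n \<in> J" "\<xi> = cls X"
    using \<xi> by (rule ideal_closure_cases) blast
  obtain Y where Y: "Y \<in> CS" "\<eta> = cls Y" using \<eta> by (rule carr_cases)
  show "cmult C \<xi> \<eta> \<in> ideal_closure J" "cmult C \<eta> \<xi> \<in> ideal_closure J"
    unfolding X(3) Y(2) C_mult[OF X(1) Y(1)] C_mult[OF Y(1) X(1)]
    by (intro ideal_closureI CS_mult mult X Y CS_in)+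
next
  fix \<Xi> :: "nat \<Rightarrow> (nat \<Rightarrow> 'g free_alg) set" and \<xi> assume "\<xi> \<in> carr C"
    "(\<forall>n. \<Xi> n \<in> ideal_closure J) \<and> (\<lambda>n. cdist C (\<Xi> n) \<xi>) \<longlonglongrightarrow> 0"
  then show "\<xi> \<in> ideal_closure J" using ideal_closure_closed[OF J(1), of \<Xi> \<xi>] by simp
qed

end

lemma ideal_generated_least:
  "closed_ideal A I \<Longrightarrow> X \<subseteq> I \<Longrightarrow> ideal_generated A X \<subseteq> I"
  by (auto simp: ideal_generated_def)

lemma ideal_generated_superset: "X \<subseteq> ideal_generated A X"
  by (auto simp: ideal_generated_def)

lemma ideal_generated_mult:
  assumes "a \<in> ideal_generated A X" "b \<in> carr A"
  shows "cmult A a b \<in> ideal_generated A X" "cmult A b a \<in> ideal_generated A X"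
  using assms unfolding ideal_generated_def closed_ideal_def by blast+

section \<open>A left unit for the algebra of a graph with finitely many vertices\<close>

text \<open>The unit is the sum of all vertex projections. Each generator and each adjoint is
  absorbed by one of them on the left, so a word is fixed through its first letter; linearity and
  limits do the rest.\<close>

lemma graph_cstar_left_unit:
  assumes G: "wf_digraph G" and fin: "finite (verts G)"
  obtains u where "u \<in> carr (graph_cstar G)"
    "\<And>\<xi>. \<xi> \<in> carr (graph_cstar G) \<Longrightarrow> cmult (graph_cstar G) u \<xi> = \<xi>"
proof -
  interpret cstar_seminormed "ck_gens G" "univ_norm (ck_gens G) (CK_relators G)"
    by (rule graph_seminormed[OF G])
  have rel: "r \<in> null_elems" if "r \<in> CK_relators G" for r
    using that CK_relators_free[OF G] by (auto simp: null_elems_def univ_norm_relator)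
  have Vin: "vproj u \<in> F" if "u \<in> verts G" for u using that by (simp add: ck_gens_def free_gen)
  have Ein: "eiso g \<in> F" if "g \<in> arcs G" for g using that by (simp add: ck_gens_def free_gen)
  define U where "U = (\<Sum>u\<in>verts G. vproj u :: ('a, 'b) ck_gen free_alg)"
  have U: "U \<in> F" unfolding U_def by (intro free_sum Vin)
  have U_vproj: "U * vproj u - vproj u \<in> null_elems" if u: "u \<in> verts G" for u
  proof -
    have "U * vproj u - vproj u
        = (\<Sum>u'\<in>verts G - {u}. vproj u' * vproj u) + (vproj u * vproj u - vproj u)"
      unfolding U_def sum_distrib_right using sum.remove[OF fin u, of "\<lambda>u'. vproj u' * vproj u :: ('a, 'b) ck_gen free_alg"]
      by simp
    also have "\<dots> \<in> null_elems"
      using u by (intro null_elems_add null_elems_sum rel) (auto simp: CK_relators_def)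
    finally show ?thesis .
  qed
  \<comment> \<open>Modulo null elements \<open>a\<close> is \<open>vproj u * b\<close>, and
    \<open>U\<close> fixes \<open>vproj u\<close> by \<open>U_vproj\<close>.\<close>
  have U_absorb: "U * a - a \<in> null_elems"
    if "u \<in> verts G" "a \<in> F" "b \<in> F" "vproj u * b - a \<in> null_elems" for u a b
  proof -
    have "U * a - a = - (U * (vproj u * b - a)) + (U * vproj u - vproj u) * b + (vproj u * b - a)"
      by (simp add: algebra_simps)
    also have "\<dots> \<in> null_elems"
      using that U by (intro null_elems_add null_elems_uminus null_elems_mult U_vproj)
    finally show ?thesis .
  qed
  have U_gen: "U * a - a \<in> null_elems"
    if x: "x \<in> ck_gens G" and a: "a = gen x \<or> a = fstar (gen x)" for x a
  proof (cases x)
    case (Vtx u)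
    with x have u: "u \<in> verts G" by (auto simp: ck_gens_def)
    have "fstar (vproj u) - vproj u \<in> CK_relators G" "vproj u * vproj u - vproj u \<in> CK_relators G"
      using u by (auto simp: CK_relators_def)
    note r = this[THEN rel]
    \<comment> \<open>The sum is \<open>vproj u * vproj u - fstar (vproj u)\<close>, which settles
      the adjoint letter with \<open>b = vproj u\<close>.\<close>
    then have "vproj u * vproj u - vproj u + - (fstar (vproj u) - vproj u) \<in> null_elems"
      by (intro null_elems_add null_elems_uminus)
    with r(2) a Vtx show ?thesis
      by (intro U_absorb[OF u _ Vin[OF u]]) (auto simp: Vin[OF u] free_closed)
  next
    case (Edg g)
    with x have g: "g \<in> arcs G" by (auto simp: ck_gens_def)
    let ?s = "eiso g :: ('a, 'b) ck_gen free_alg"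
    note s = Ein[OF g]
    have "?s * fstar ?s * ?s - ?s \<in> CK_relators G"
      "fstar ?s * ?s - vproj (head G g) \<in> CK_relators G"
      "vproj (tail G g) * erange g - erange g \<in> CK_relators G"
      using g by (auto simp: CK_relators_def)
    note r = this[THEN rel]
    from a show ?thesis
    proof
      assume a: "a = gen x"
      \<comment> \<open>The terms \<open>?s * fstar ?s * ?s\<close> cancel, leaving the hypothesis
        of \<open>U_absorb\<close> with \<open>b = ?s * fstar ?s * ?s\<close>.\<close>
      have "(vproj (tail G g) * erange g - erange g) * ?s + (?s * fstar ?s * ?s - ?s) \<in> null_elems"
        by (intro null_elems_add null_elems_mult r s)
      then have "vproj (tail G g) * (?s * fstar ?s * ?s) - ?s \<in> null_elems"
        by (simp add: algebra_simps)
      then show ?thesis unfolding a Edg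
        by (intro U_absorb[OF wf_digraph.tail_in_verts[OF G g] s]) (simp_all add: s free_closed)
    next
      assume a: "a = fstar (gen x)"
      \<comment> \<open>Here \<open>fstar ?s * ?s * fstar ?s\<close> cancels: an adjoint edge is
        absorbed by the projection at the range of the edge.\<close>
      have "- ((fstar ?s * ?s - vproj (head G g)) * fstar ?s) + fstar (?s * fstar ?s * ?s - ?s)
          \<in> null_elems"
        by (intro null_elems_add null_elems_uminus null_elems_mult null_elems_fstar r free_fstar s)
      then have "vproj (head G g) * fstar ?s - fstar ?s \<in> null_elems"
        by (simp add: algebra_simps fstar_mult fstar_minus)
      then show ?thesis unfolding a Edg
        by (intro U_absorb[OF wf_digraph.head_in_verts[OF G g] free_fstar[OF s]])
          (simp_all add: s free_closed)
    qed
  qed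
  have U_word: "U * Poly_Mapping.single z c - Poly_Mapping.single z c \<in> null_elems"
    if z: "letters z \<noteq> []" "base ` set (letters z) \<subseteq> ck_gens G" for z c
  proof -
    obtain l ls where ls: "z = Word (l # ls)" using z(1) by (metis fword.collapse neq_Nil_conv)
    let ?l = "Poly_Mapping.single (Word [l]) (1::complex)"
    have "?l = gen (base l) \<or> ?l = fstar (gen (base l))"
      by (cases l) (simp_all add: gen_def fstar_single adj_word_def)
    then have l: "U * ?l - ?l \<in> null_elems" using z ls by (intro U_gen) auto
    show ?thesis
    \<comment> \<open>The remaining word belongs to \<open>F\<close> only if it is nonempty, since
      \<open>F\<close> has no constant terms.\<close>
    proof (cases "ls = []")
      case True
      then have "U * Poly_Mapping.single z c - Poly_Mapping.single z c = fscale c (U * ?l - ?l)"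
        using ls fscale_mult(2)[of U c ?l] by (simp add: fscale_add fscale_single)
      with null_elems_fscale[OF l] show ?thesis by simp
    next
      case False
      let ?r = "Poly_Mapping.single (Word ls) c"
      have eq: "Poly_Mapping.single z c = ?l * ?r" by (simp add: ls mult_single plus_fword_def)
      have "?r \<in> F" using z ls False by (simp add: free_star_alg_def)
      from null_elems_mult(1)[OF l this] show ?thesis
        by (simp add: eq left_diff_distrib mult.assoc)
    qed
  qed
  have U_unit: "U * a - a \<in> null_elems" if "a \<in> F" for a
  proof -
    let ?t = "\<lambda>z. Poly_Mapping.single z (Poly_Mapping.lookup a z)"
    have "U * a - a = (\<Sum>z\<in>Poly_Mapping.keys a. U * ?t z - ?t z)"
      by (simp add: sum_subtractf flip: sum_distrib_left free_alg_eq_sum)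
    also have "\<dots> \<in> null_elems"
      using that by (intro null_elems_sum U_word) (auto simp: free_star_alg_def)
    finally show ?thesis .
  qed
  show thesis
  proof (rule that)
    show "cls (\<lambda>n. U) \<in> carr (graph_cstar G)"
      unfolding graph_cstar_def universal_cstar_def by (intro cls_in CS_const U)
    fix \<xi> assume "\<xi> \<in> carr (graph_cstar G)"
    then obtain X where X: "X \<in> CS" "\<xi> = cls X"
      unfolding graph_cstar_def universal_cstar_def by (rule carr_cases)
    have "cls (\<lambda>n. U * X n) = cls X"
      using null_elemsD(2)[OF U_unit[OF CS_in[OF X(1)]]]
      by (subst cls_eq_iff) (auto intro!: CS_mult CS_const U X)
    then show "cmult (graph_cstar G) (cls (\<lambda>n. U)) \<xi> = \<xi>"
      unfolding graph_cstar_def universal_cstar_def X(2)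
      by (subst C_mult) (auto intro!: CS_const U X)
  qed
qed


section \<open>The Toeplitz representation of the two-cycle\<close>

text \<open>Composition with \<sigma>, cut off outside \<open>P\<close>. If \<sigma> is injective on
  \<open>P\<close>, supports stay finite and this is a partial isometry; both the vertex projections
  and the shifts have this form.\<close>

definition pull :: "nat set \<Rightarrow> (nat \<Rightarrow> nat) \<Rightarrow> (nat \<Rightarrow>\<^sub>0 complex) \<Rightarrow> (nat \<Rightarrow>\<^sub>0 complex)" where
  "pull P \<sigma> f = Abs_poly_mapping (\<lambda>i. if i \<in> P then Poly_Mapping.lookup f (\<sigma> i) else 0)"

lemma lookup_pull:
  assumes "inj_on \<sigma> P"
  shows "Poly_Mapping.lookup (pull P \<sigma> f) i = (if i \<in> P then Poly_Mapping.lookup f (\<sigma> i) else 0)"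
proof -
  have "{i. (if i \<in> P then Poly_Mapping.lookup f (\<sigma> i) else 0) \<noteq> 0}
      \<subseteq> \<sigma> -` Poly_Mapping.keys f \<inter> P"
    by (auto simp: in_keys_iff split: if_splits)
  then have "finite {i. (if i \<in> P then Poly_Mapping.lookup f (\<sigma> i) else 0) \<noteq> 0}"
    using finite_vimage_IntI[OF finite_keys assms] by (rule finite_subset)
  then show ?thesis by (simp add: pull_def)
qed

text \<open>Reindexing the sum along \<sigma> shows that the inverse partial bijection gives the
  adjoint.\<close>

lemma pull_adjoint:
  assumes \<sigma>: "inj_on \<sigma> P" and \<tau>: "inj_on \<tau> (\<sigma> ` P)" "\<And>i. i \<in> P \<Longrightarrow> \<tau> (\<sigma> i) = i"
  shows "pull P \<sigma> f \<bullet> g = f \<bullet> pull (\<sigma> ` P) \<tau> g"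
proof -
  let ?K = "\<sigma> -` Poly_Mapping.keys f \<inter> P"
  have fin: "finite ?K" using \<sigma> by (intro finite_vimage_IntI) auto
  have "pull P \<sigma> f \<bullet> g = (\<Sum>i\<in>?K. Poly_Mapping.lookup (pull P \<sigma> f) i \<bullet> Poly_Mapping.lookup g i)"
    using fin
    by (rule inner_poly_mapping_superset)
      (auto simp: in_keys_iff lookup_pull[OF \<sigma>] split: if_splits)
  also have "\<dots> = (\<Sum>i\<in>?K. Poly_Mapping.lookup f (\<sigma> i)
      \<bullet> Poly_Mapping.lookup (pull (\<sigma> ` P) \<tau> g) (\<sigma> i))"
    by (rule sum.cong) (auto simp: lookup_pull \<sigma> \<tau>)
  also have "\<dots> = (\<Sum>j\<in>\<sigma> ` ?K. Poly_Mapping.lookup f j \<bullet> Poly_Mapping.lookup (pull (\<sigma> ` P) \<tau> g) j)"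
    by (subst sum.reindex) (auto intro: inj_on_subset[OF \<sigma>])
  also have "\<dots> = f \<bullet> pull (\<sigma> ` P) \<tau> g"
    unfolding inner_poly_mapping_def
    by (rule sum.mono_neutral_left) (auto simp: lookup_pull \<tau>)
  finally show ?thesis .
qed

text \<open>The bound 1 holds because injectivity lets each coordinate of \<open>f\<close> occur at
  most once.\<close>

lemma bounded_linear_pull:
  assumes \<sigma>: "inj_on \<sigma> P"
  shows "bounded_linear (pull P \<sigma>)"
proof (rule bounded_linear_intro[where K = 1])
  fix f :: "nat \<Rightarrow>\<^sub>0 complex"
  let ?K = "\<sigma> -` Poly_Mapping.keys f \<inter> P"
  let ?n = "\<lambda>j. Poly_Mapping.lookup f j \<bullet> Poly_Mapping.lookup f j"
  have fin: "finite ?K" using \<sigma> by (intro finite_vimage_IntI) auto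
  have "pull P \<sigma> f \<bullet> pull P \<sigma> f
      = (\<Sum>i\<in>?K. Poly_Mapping.lookup (pull P \<sigma> f) i \<bullet> Poly_Mapping.lookup (pull P \<sigma> f) i)"
    using fin
    by (rule inner_poly_mapping_superset)
      (auto simp: in_keys_iff lookup_pull[OF \<sigma>] split: if_splits)
  also have "\<dots> = (\<Sum>i\<in>?K. ?n (\<sigma> i))"
    by (rule sum.cong) (auto simp: lookup_pull \<sigma>)
  also have "\<dots> = sum ?n (\<sigma> ` ?K)"
    by (subst sum.reindex) (auto intro: inj_on_subset[OF \<sigma>])
  also have "\<dots> \<le> f \<bullet> f"
    unfolding inner_poly_mapping_def by (rule sum_mono2) auto
  finally show "norm (pull P \<sigma> f) \<le> norm f * 1" by (simp add: norm_eq_sqrt_inner)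
qed (rule poly_mapping_eqI, simp add: lookup_pull[OF \<sigma>] lookup_add)+

lemma pull_cscl: "inj_on \<sigma> P \<Longrightarrow> pull P \<sigma> (cscl c f) = cscl c (pull P \<sigma> f)"
  by (rule poly_mapping_eqI) (simp add: lookup_pull)

section \<open>The graph, its admissible pair and the vertices of the new graph\<close>

locale two_cycle =
  fixes E :: "('v, 'e) pre_digraph" and v w x :: 'v and e f :: 'e
  assumes wf: "wf_digraph E"
    and verts: "verts E = {v, w, x}" and distinct: "distinct [v, w, x]"
    and arcs_vw: "{g \<in> arcs E. tail E g = v \<and> head E g = w} = {e}"
    and arcs_wv: "{g \<in> arcs E. tail E g = w \<and> head E g = v} = {f}"
    and infinite_vx: "infinite {g \<in> arcs E. tail E g = v \<and> head E g = x}"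
    and infinite_wx: "infinite {g \<in> arcs E. tail E g = w \<and> head E g = x}"
    and arcs_ends: "\<forall>g \<in> arcs E. (tail E g, head E g) \<in> {(v, w), (w, v), (v, x), (w, x)}"
begin

lemma ef: "e \<in> arcs E" "tail E e = v" "head E e = w" "f \<in> arcs E" "tail E f = w" "head E f = v"
  using arcs_vw arcs_wv by auto

lemma arc_cases:
  assumes "g \<in> arcs E"
  obtains "g = e" | "g = f" | "head E g = x"
proof -
  have "(tail E g, head E g) \<in> {(v, w), (w, v), (v, x), (w, x)}" using arcs_ends assms by blast
  moreover have "g \<in> {e}" if "tail E g = v" "head E g = w"
    unfolding arcs_vw[symmetric] using that assms by simp
  moreover have "g \<in> {f}" if "tail E g = w" "head E g = v"
    unfolding arcs_wv[symmetric] using that assms by simp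
  ultimately show thesis using that by auto
qed

lemma infinite_out_arcs: "infinite (out_arcs E v)" "infinite (out_arcs E w)"
  using infinite_super[OF _ infinite_vx, of "out_arcs E v"]
    infinite_super[OF _ infinite_wx, of "out_arcs E w"]
  by (auto simp: out_arcs_def)

lemma out_arcs_x: "out_arcs E x = {}"
  using arcs_ends distinct by (auto simp: out_arcs_def)

text \<open>Makes saturation and the summation relators vacuous: \<open>v\<close> and
  \<open>w\<close> emit infinitely many edges, \<open>x\<close> emits none.\<close>

lemma not_regular: "\<not> regular_vertex E u"
  using infinite_out_arcs out_arcs_x verts by (auto simp: regular_vertex_def)

lemma arcs_outside_eq: "arcs_outside E {x} v = {e}" "arcs_outside E {x} w = {f}"
  using ef distinct by (auto simp: arcs_outside_def out_arcs_def elim: arc_cases)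

lemma admissible: "admissible_pair E {x} {v, w}"
  using arcs_ends distinct verts not_regular infinite_out_arcs
  by (auto simp: admissible_pair_def hereditary_def saturated_def breaking_vertices_def
      arcs_outside_eq)

lemma finite_verts_DHS: "finite (verts (DHS_graph E {x} {v, w}))"
proof -
  have "new_paths E {x} {v, w} \<subseteq> {[e], [f]}"
  proof
    fix \<alpha> assume \<alpha>: "\<alpha> \<in> new_paths E {x} {v, w}"
    then obtain u z where *: "\<alpha> \<noteq> []" "pre_digraph.awalk E u \<alpha> z" "u \<noteq> x"
        "\<forall>g\<in>set (butlast \<alpha>). head E g \<notin> verts E"
      by (auto simp: new_paths_def entry_paths_def verts)
    then have sub: "set \<alpha> \<subseteq> arcs E" by (simp add: pre_digraph.awalk_def)
    \<comment> \<open>Since \<open>{x}\<close> and \<open>{v, w}\<close> exhaust the vertices, no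
      edge may precede the last one.\<close>
    have "set (butlast \<alpha>) = {}"
      using *(4) sub wf_digraph.head_in_verts[OF wf] by (meson in_set_butlastD subset_iff equals0I)
    then obtain g where g: "\<alpha> = [g]" using *(1) by (cases \<alpha> rule: rev_cases) auto
    \<comment> \<open>A single edge into \<open>x\<close> starts at \<open>v\<close> or
      \<open>w\<close>, so it was removed in \<open>new_paths\<close>.\<close>
    with \<alpha> sub have "g \<in> arcs E" "head E g = x \<longrightarrow> tail E g \<notin> {v, w}" by (auto simp: new_paths_def)
    then show "\<alpha> \<in> {[e], [f]}" unfolding g using arcs_ends by (auto elim: arc_cases)
  qed
  then show ?thesis by (auto simp: DHS_graph_def intro: finite_subset)
qed

text \<open>
  The quotient by the ideal of \<open>x\<close> is represented on the paths ending at a sink adjoined to \<open>v\<close>: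
  the basis vector \<open>n\<close> is the path of length \<open>n\<close>, which starts at \<open>v\<close> for even and at \<open>w\<close> for
  odd \<open>n\<close>.
\<close>

definition vertex_basis :: "'v \<Rightarrow> nat set" where
  "vertex_basis u = (if u = v then {i. even i} else if u = w then {i. odd i} else {})"

text \<open>The paths whose first edge is \<open>g\<close>. The empty path has even length but no
  first edge, hence \<open>0 < i\<close>; this excluded vector is what the gap projection at
  \<open>v\<close> sees. Edges into \<open>x\<close> act as zero.\<close>

definition arc_basis :: "'e \<Rightarrow> nat set" where
  "arc_basis g = (if g = e then {i. even i \<and> 0 < i} else if g = f then {i. odd i} else {})"

text \<open>Reading coordinate \<open>i\<close> from \<open>i - 1\<close> moves basis vector
  \<open>n\<close> to \<open>n + 1\<close>, so an edge is prepended to a path; its adjoint deletes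
  the first edge. Truncated subtraction is harmless because no \<open>arc_basis g\<close> contains
  0.\<close>

definition cycle_op :: "('v, 'e) ck_gen letter \<Rightarrow> (nat \<Rightarrow>\<^sub>0 complex) \<Rightarrow> (nat \<Rightarrow>\<^sub>0 complex)" where
  "cycle_op l = (case l of
      Gen (Vtx u) \<Rightarrow> pull (vertex_basis u) id
    | Adj (Vtx u) \<Rightarrow> pull (vertex_basis u) id
    | Gen (Edg g) \<Rightarrow> pull (arc_basis g) (\<lambda>i. i - Suc 0)
    | Adj (Edg g) \<Rightarrow> pull {i. Suc i \<in> arc_basis g} Suc)"

lemma pos_arc_basis: "i \<in> arc_basis g \<Longrightarrow> 0 < i"
  by (auto simp: arc_basis_def odd_pos split: if_splits)

section \<open>The path representation and its Cuntz-Krieger relations\<close>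

lemma inj_pred_arc_basis: "inj_on (\<lambda>i. i - Suc 0) (arc_basis g)"
proof (rule inj_onI)
  fix i j assume "i \<in> arc_basis g" "j \<in> arc_basis g" "i - Suc 0 = j - Suc 0"
  then show "i = j" using pos_arc_basis[of i g] pos_arc_basis[of j g] by simp
qed

lemma image_Suc_arc_basis: "Suc ` {i. Suc i \<in> arc_basis g} = arc_basis g"
proof
  show "arc_basis g \<subseteq> Suc ` {i. Suc i \<in> arc_basis g}"
  proof
    fix i assume "i \<in> arc_basis g"
    then show "i \<in> Suc ` {i. Suc i \<in> arc_basis g}"
      using pos_arc_basis[of i g] by (cases i) auto
  qed
qed auto

lemma image_pred_arc_basis: "(\<lambda>i. i - Suc 0) ` arc_basis g = {i. Suc i \<in> arc_basis g}"
  by (subst image_Suc_arc_basis[symmetric]) (simp add: image_image)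

sublocale free_rep cycle_op
proof (rule free_rep.intro)
  fix l :: "('v, 'e) ck_gen letter" and c :: complex and \<xi> \<eta> :: "nat \<Rightarrow>\<^sub>0 complex"
  show "bounded_linear (cycle_op l)"
    by (auto simp: cycle_op_def intro!: bounded_linear_pull inj_pred_arc_basis
        split: letter.split ck_gen.split)
  show "cycle_op l (cscl c \<xi>) = cscl c (cycle_op l \<xi>)"
    by (auto simp: cycle_op_def intro!: pull_cscl inj_pred_arc_basis
        split: letter.split ck_gen.split)
  have 1: "pull (vertex_basis u) id \<xi> \<bullet> \<eta> = \<xi> \<bullet> pull (vertex_basis u) id \<eta>" for u
    using pull_adjoint[of id "vertex_basis u" id \<xi> \<eta>] by simp
  have 2: "pull (arc_basis g) (\<lambda>i. i - Suc 0) \<xi> \<bullet> \<eta> = \<xi> \<bullet> pull {i. Suc i \<in> arc_basis g} Suc \<eta>" for g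
    using pull_adjoint[OF inj_pred_arc_basis, of Suc g \<xi> \<eta>] pos_arc_basis
    by (simp add: image_pred_arc_basis)
  have 3: "pull {i. Suc i \<in> arc_basis g} Suc \<xi> \<bullet> \<eta> = \<xi> \<bullet> pull (arc_basis g) (\<lambda>i. i - Suc 0) \<eta>" for g
    using pull_adjoint[of Suc "{i. Suc i \<in> arc_basis g}" "\<lambda>i. i - Suc 0" \<xi> \<eta>] inj_pred_arc_basis
    by (simp add: image_Suc_arc_basis)
  show "cycle_op l \<xi> \<bullet> \<eta> = \<xi> \<bullet> cycle_op (adj_letter l) \<eta>"
    by (auto simp: cycle_op_def 1 2 3 split: letter.split ck_gen.split)
qed

lemma lookup_cycle_op:
  "Poly_Mapping.lookup (cycle_op (Gen (Vtx u)) \<xi>) i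
    = (if i \<in> vertex_basis u then Poly_Mapping.lookup \<xi> i else 0)"
  "Poly_Mapping.lookup (cycle_op (Adj (Vtx u)) \<xi>) i
    = (if i \<in> vertex_basis u then Poly_Mapping.lookup \<xi> i else 0)"
  "Poly_Mapping.lookup (cycle_op (Gen (Edg g)) \<xi>) i
    = (if i \<in> arc_basis g then Poly_Mapping.lookup \<xi> (i - 1) else 0)"
  "Poly_Mapping.lookup (cycle_op (Adj (Edg g)) \<xi>) i
    = (if Suc i \<in> arc_basis g then Poly_Mapping.lookup \<xi> (Suc i) else 0)"
  by (simp_all add: cycle_op_def lookup_pull inj_pred_arc_basis)

lemma op_vproj:
  "Poly_Mapping.lookup (op (vproj u) \<xi>) i
    = (if i \<in> vertex_basis u then Poly_Mapping.lookup \<xi> i else 0)"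
  by (simp add: op_gen lookup_cycle_op)

lemma op_erange:
  "Poly_Mapping.lookup (op (erange g) \<xi>) i
    = (if i \<in> arc_basis g then Poly_Mapping.lookup \<xi> i else 0)"
  using pos_arc_basis[of i g] by (auto simp: op_mult op_gen lookup_cycle_op)

lemma op_relator:
  assumes "r \<in> CK_relators E" shows "op r \<xi> = 0"
proof -
  have ne: "e \<noteq> f" "v \<noteq> w" using ef distinct by auto
  \<comment> \<open>A path with first edge \<open>g\<close> starts at the source of
    \<open>g\<close>; by \<open>hd\<close> below, \<open>g\<close> can be prepended exactly to the
    paths starting at its range. These give the relators for range and source projections.\<close>
  have tl: "i \<in> vertex_basis (tail E g)" if "i \<in> arc_basis g" for i g
    using that ef ne by (auto simp: arc_basis_def vertex_basis_def split: if_splits)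
  have hd: "Suc i \<in> arc_basis g \<longleftrightarrow> i \<in> vertex_basis (head E g)" if "g \<in> arcs E" for i g
    using that ef ne distinct by (auto simp: arc_basis_def vertex_basis_def elim: arc_cases)
  show ?thesis
    using assms unfolding CK_relators_def
    by (elim UnE CollectE exE conjE)
      (auto intro!: poly_mapping_eqI simp: op_minus op_vproj op_mult op_gen lookup_minus
        lookup_cycle_op not_regular tl hd pos_arc_basis,
       auto simp: vertex_basis_def arc_basis_def ne split: if_splits)
qed

text \<open>Every path of odd length has first edge \<open>f\<close>.\<close>

lemma op_gap_proj_w: "op (gap_proj E {x} w) \<xi> = 0"
  using ef distinct
  by (intro poly_mapping_eqI)
    (auto simp: gap_proj_def arcs_outside_eq op_minus lookup_minus op_vproj op_erange
      vertex_basis_def arc_basis_def)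

text \<open>The empty path is the only path of even length without first edge
  \<open>e\<close>.\<close>

lemma op_gap_proj_v: "op (gap_proj E {x} v) \<xi> = Poly_Mapping.single 0 (Poly_Mapping.lookup \<xi> 0)"
  by (intro poly_mapping_eqI)
    (auto simp: gap_proj_def arcs_outside_eq op_minus lookup_minus op_vproj op_erange
      vertex_basis_def arc_basis_def lookup_single when_def)

text \<open>Turns norm estimates in the graph algebra into estimates for operators on basis
  vectors.\<close>

lemma op_le_univ_norm:
  assumes a: "a \<in> free_star_alg (ck_gens E)"
  shows "onorm (op a) \<le> univ_norm (ck_gens E) (CK_relators E) a"
proof -
  have "(\<lambda>a. onorm (op a)) \<in> relation_seminorms (ck_gens E) (CK_relators E)"
    by (simp add: relation_seminorms_def cstar_seminorm_onorm op_relator onorm_eq_0[OF bounded_op])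
  moreover have "bdd_above ((\<lambda>q. q a) ` relation_seminorms (ck_gens E) (CK_relators E))"
    by (auto intro!: bdd_aboveI2 CK_seminorm_bdd[OF wf] a)
  ultimately show ?thesis unfolding univ_norm_alt by (auto intro: cSUP_upper2)
qed

section \<open>Elements that annihilate all but finitely many basis vectors\<close>

abbreviation basis_vec :: "nat \<Rightarrow> nat \<Rightarrow>\<^sub>0 complex" where
  "basis_vec n \<equiv> Poly_Mapping.single n 1"

text \<open>Quantifying over the right factor \<open>b\<close> makes this a two-sided ideal by construction.\<close>

definition vanishing :: "('v, 'e) ck_gen free_alg set" where
  "vanishing = {a \<in> free_star_alg (ck_gens E).
     \<forall>b. \<forall>\<^sub>F n in sequentially. op (a * b) (basis_vec n) = 0}"

lemma vanishingD:
  assumes "a \<in> vanishing"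
  shows "a \<in> free_star_alg (ck_gens E)" "\<forall>\<^sub>F n in sequentially. op (a * b) (basis_vec n) = 0"
  using assms by (auto simp: vanishing_def)

lemma vanishing_zeroI:
  "a \<in> free_star_alg (ck_gens E) \<Longrightarrow> (\<And>\<xi>. op a \<xi> = 0) \<Longrightarrow> a \<in> vanishing"
  by (simp add: vanishing_def op_mult)

lemma gens_free:
  "u \<in> {v, w, x} \<Longrightarrow> vproj u \<in> free_star_alg (ck_gens E)"
  "g \<in> arcs E \<Longrightarrow> eiso g \<in> free_star_alg (ck_gens E)"
  by (rule free_gen, auto simp: ck_gens_def verts)+

lemma gap_proj_free: "u \<in> {v, w} \<Longrightarrow> gap_proj E {x} u \<in> free_star_alg (ck_gens E)"
  by (auto simp: gap_proj_def arcs_outside_eq ef intro!: free_minus free_mult free_fstar gens_free)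

text \<open>Only the gap projection at \<open>v\<close> acts nontrivially. Multiplied by
  \<open>b\<close> it keeps coordinate 0 of the image of \<open>basis_vec n\<close>, which by
  adjointness is controlled by coordinate \<open>n\<close> of the finitely supported image of vector
  0 under \<open>fstar b\<close>.\<close>

lemma generators_vanishing:
  "vproj x \<in> vanishing" "gap_proj E {x} w \<in> vanishing" "gap_proj E {x} v \<in> vanishing"
proof -
  show "vproj x \<in> vanishing"
    using distinct
    by (intro vanishing_zeroI gens_free poly_mapping_eqI) (auto simp: op_vproj vertex_basis_def)
  show "gap_proj E {x} w \<in> vanishing"
    by (intro vanishing_zeroI gap_proj_free op_gap_proj_w) simp
  have "\<forall>\<^sub>F n in sequentially. op (gap_proj E {x} v * b) (basis_vec n) = 0" for b
  proof -
    have "\<forall>\<^sub>F n in sequentially. n \<notin> Poly_Mapping.keys \<xi>" for \<xi> :: "nat \<Rightarrow>\<^sub>0 complex"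
    proof -
      obtain m where "\<forall>n\<in>Poly_Mapping.keys \<xi>. n < m"
        using finite_nat_set_iff_bounded[of "Poly_Mapping.keys \<xi>"] by auto
      then show ?thesis unfolding eventually_sequentially by (meson not_le)
    qed
    \<comment> \<open>The real inner product with 1 gives the real part of a coordinate and the one
      with \<i> its imaginary part, so both tests are needed.\<close>
    from eventually_conj[OF this[of "op (fstar b) (Poly_Mapping.single 0 1)"]
        this[of "op (fstar b) (Poly_Mapping.single 0 \<i>)"]]
    show ?thesis
    proof (rule eventually_mono)
      fix n
      assume n: "n \<notin> Poly_Mapping.keys (op (fstar b) (Poly_Mapping.single 0 1)) \<and>
        n \<notin> Poly_Mapping.keys (op (fstar b) (Poly_Mapping.single 0 \<i>))"
      have "Poly_Mapping.lookup (op b (basis_vec n)) 0 \<bullet> z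
          = Poly_Mapping.lookup (op (fstar b) (Poly_Mapping.single 0 z)) n \<bullet> 1" for z
        using op_adjoint[of b "basis_vec n" "Poly_Mapping.single 0 z"]
        by (simp add: inner_single_right inner_commute[of "basis_vec n"])
      from this[of 1] this[of \<i>] n have "Poly_Mapping.lookup (op b (basis_vec n)) 0 = 0"
        by (simp add: in_keys_iff inner_complex_def complex_eq_iff)
      then show "op (gap_proj E {x} v * b) (basis_vec n) = 0" by (simp add: op_mult op_gap_proj_v)
    qed
  qed
  then show "gap_proj E {x} v \<in> vanishing" by (simp add: vanishing_def gap_proj_free)
qed

text \<open>The path of length \<open>n\<close> along the cycle that ends at \<open>v\<close>. Its
  last edge is \<open>f\<close>, so \<open>f\<close> is prepended first. It shows that every basis
  vector is reached from vector 0.\<close>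

fun route :: "nat \<Rightarrow> ('v, 'e) ck_gen free_alg" where
  "route 0 = vproj v"
| "route (Suc n) = (if even n then eiso f else eiso e) * route n"

lemma route_free: "route n \<in> free_star_alg (ck_gens E)"
  by (induction n) (auto intro!: free_mult gens_free simp: ef)

lemma op_route: "op (route n) (basis_vec 0) = basis_vec n"
proof (induction n)
  case 0
  show ?case
    by (rule poly_mapping_eqI) (simp add: op_vproj vertex_basis_def lookup_one when_def)
next
  case (Suc n)
  have "e \<noteq> f" using ef distinct by auto
  have "op (if even n then eiso f else eiso e) (basis_vec n) = basis_vec (Suc n)"
    using \<open>e \<noteq> f\<close>
    by (intro poly_mapping_eqI) (auto simp: op_gen lookup_cycle_op arc_basis_def lookup_single when_def)
  with Suc show ?case by (simp add: op_mult)
qed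

text \<open>The closure of \<open>vanishing\<close> is a closed ideal containing the generators, so
  minimality of the generated ideal applies.\<close>

lemma pair_ideal_subset:
  "pair_ideal E {x} {v, w} \<subseteq> cstar_seminormed.ideal_closure (ck_gens E)
     (univ_norm (ck_gens E) (CK_relators E)) vanishing"
  "pair_ideal E {x} {v, w} \<subseteq> carr (graph_cstar E)"
proof -
  interpret cstar_seminormed "ck_gens E" "univ_norm (ck_gens E) (CK_relators E)"
    by (rule graph_seminormed[OF wf])
  have C: "graph_cstar E = C" by (simp add: graph_cstar_def universal_cstar_def)
  have embed: "graph_embed E a = cls (\<lambda>n. a)" for a
    by (simp add: graph_embed_def univ_embed_def)
  have ideal: "closed_ideal C (ideal_closure vanishing)"
  proof (rule closed_ideal_closure)
    fix a b c assume a: "a \<in> vanishing"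
    have "\<forall>\<^sub>F n in sequentially. op (fscale c a * d) (basis_vec n) = 0" for d
      using vanishingD(2)[OF a, of d]
      by (rule eventually_mono) (simp add: fscale_mult op_fscale cscl_algebra)
    then show "fscale c a \<in> vanishing"
      using vanishingD(1)[OF a] by (simp add: vanishing_def free_fscale)
    show "a + b \<in> vanishing" if b: "b \<in> vanishing"
    proof -
      have "\<forall>\<^sub>F n in sequentially. op ((a + b) * d) (basis_vec n) = 0" for d
        using vanishingD(2)[OF a, of d] vanishingD(2)[OF b, of d]
        by eventually_elim (simp add: distrib_right op_add)
      then show ?thesis
        using vanishingD(1)[OF a] vanishingD(1)[OF b] by (simp add: vanishing_def free_add)
    qed
    assume b: "b \<in> F"
    show "a * b \<in> vanishing"
      using vanishingD[OF a] b by (simp add: vanishing_def free_mult mult.assoc)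
    have "\<forall>\<^sub>F n in sequentially. op (b * a * d) (basis_vec n) = 0" for d
      using vanishingD(2)[OF a, of d]
      by (rule eventually_mono) (simp add: mult.assoc op_mult[of b] op_linear)
    then show "b * a \<in> vanishing"
      using vanishingD(1)[OF a] b by (simp add: vanishing_def free_mult)
  qed (auto simp: vanishing_def free_zero)
  have "cls (\<lambda>n. a) \<in> ideal_closure vanishing" if "a \<in> vanishing" for a
    using that by (intro ideal_closureI CS_const) (auto simp: vanishing_def)
  then show "pair_ideal E {x} {v, w} \<subseteq> ideal_closure vanishing"
    unfolding pair_ideal_def C embed using generators_vanishing ideal
    by (intro ideal_generated_least) auto
  also have "\<dots> \<subseteq> carr C" using ideal by (simp add: closed_ideal_def)
  finally show "pair_ideal E {x} {v, w} \<subseteq> carr (graph_cstar E)" unfolding C .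
qed

section \<open>Absence of a left unit in the ideal\<close>

text \<open>A left unit is approximated by some \<open>X K\<close> that kills a vector
  \<open>basis_vec n\<close>, while it must fix an element of the ideal that maps vector 0 to
  \<open>basis_vec n\<close>. Two errors below 1/2 then contradict the norm 1 of that
  vector.\<close>

lemma pair_ideal_no_left_unit:
  assumes u: "u \<in> pair_ideal E {x} {v, w}"
    and unit: "\<And>\<xi>. \<xi> \<in> pair_ideal E {x} {v, w} \<Longrightarrow> cmult (graph_cstar E) u \<xi> = \<xi>"
  shows False
proof -
  interpret cstar_seminormed "ck_gens E" "univ_norm (ck_gens E) (CK_relators E)"
    by (rule graph_seminormed[OF wf])
  let ?q = "univ_norm (ck_gens E) (CK_relators E)" and ?p = "gap_proj E {x} v"
  have C: "graph_cstar E = C" by (simp add: graph_cstar_def universal_cstar_def)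
  have embed: "graph_embed E a = cls (\<lambda>n. a)" for a
    by (simp add: graph_embed_def univ_embed_def)
  from subsetD[OF pair_ideal_subset(1) u]
  obtain X where X: "X \<in> CS" "\<And>n. X n \<in> vanishing" "u = cls X"
    by (blast elim: ideal_closure_cases)
  obtain K where K: "\<forall>m\<ge>K. \<forall>n\<ge>K. ?q (X m - X n) < 1/2" using CS_cauchy[OF X(1), of "1/2"] by auto
  \<comment> \<open>The right factor in \<open>vanishing\<close> ranges over the unital ring, so it
    may be 1.\<close>
  have "\<forall>\<^sub>F n in sequentially. op (X K * 1) (basis_vec n) = 0" by (rule vanishingD(2)[OF X(2)])
  then obtain n where n: "op (X K) (basis_vec n) = 0" by (auto simp: eventually_sequentially)
  \<comment> \<open>The gap projection puts this element into the ideal and fixes vector 0, which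
    the route then carries to \<open>basis_vec n\<close>.\<close>
  let ?t = "route n * ?p"
  have t: "?t \<in> F" by (intro free_mult route_free gap_proj_free) simp
  have op_t: "op ?t (basis_vec 0) = basis_vec n"
    using op_route[of n] by (simp add: op_mult op_gap_proj_v)
  have "cls (\<lambda>n. ?p) \<in> pair_ideal E {x} {v, w}"
    unfolding pair_ideal_def embed by (rule subsetD[OF ideal_generated_superset]) auto
  then have "cmult C (cls (\<lambda>k. route n)) (cls (\<lambda>k. ?p)) \<in> pair_ideal E {x} {v, w}"
    unfolding pair_ideal_def C by (intro ideal_generated_mult cls_in CS_const route_free)
  then have "cls (\<lambda>k. ?t) \<in> pair_ideal E {x} {v, w}"
    by (subst (asm) C_mult) (auto intro!: CS_const route_free gap_proj_free)
  from unit[OF this] have "cls (\<lambda>k. X k * ?t) = cls (\<lambda>k. ?t)"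
    unfolding C X(3) by (simp add: C_mult X(1) CS_const t)
  then have "(\<lambda>k. ?q (X k * ?t - ?t)) \<longlonglongrightarrow> 0"
    by (subst (asm) cls_eq_iff) (auto intro!: CS_mult CS_const X(1) t)
  then have "\<forall>\<^sub>F k in sequentially. ?q (X k * ?t - ?t) < 1/2" by (rule order_tendstoD(2)) simp
  then obtain L where L: "\<And>k. k \<ge> L \<Longrightarrow> ?q (X k * ?t - ?t) < 1/2"
    by (auto simp: eventually_sequentially)
  define k where "k = max K L"
  have op_bound: "norm (op a (basis_vec m)) \<le> ?q a" if "a \<in> F" for a m
    using norm_op_le[of a "basis_vec m"] op_le_univ_norm[OF that]
    by (simp add: norm_single_poly_mapping)
  \<comment> \<open>The \<open>X K\<close> term vanishes by the choice of \<open>n\<close>, and the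
    two \<open>X k\<close> terms cancel because \<open>?t\<close> maps vector 0 to
    \<open>basis_vec n\<close>.\<close>
  have "basis_vec n = op (X k - X K) (basis_vec n) - op (X k * ?t - ?t) (basis_vec 0)"
    unfolding op_minus op_mult[of _ ?t] op_t n by simp
  then have "norm (basis_vec n)
      \<le> norm (op (X k - X K) (basis_vec n)) + norm (op (X k * ?t - ?t) (basis_vec 0))"
    by (metis norm_triangle_ineq4)
  also have "\<dots> \<le> ?q (X k - X K) + ?q (X k * ?t - ?t)"
    by (intro add_mono op_bound free_minus free_mult CS_in[OF X(1)] t)
  also have "\<dots> < 1/2 + 1/2" using K L[of k] by (intro add_strict_mono) (auto simp: k_def)
  finally show False by (simp add: norm_single_poly_mapping)
qed

end

section \<open>Comparison of the two algebras through left units\<close>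

theorem mainTheorem5:
  fixes E :: "('v, 'e) pre_digraph" and v w x :: 'v and e f :: 'e
  assumes "wf_digraph E"
    and "verts E = {v, w, x}" and "distinct [v, w, x]"
    and "{g \<in> arcs E. tail E g = v \<and> head E g = w} = {e}"
    and "{g \<in> arcs E. tail E g = w \<and> head E g = v} = {f}"
    and "infinite {g \<in> arcs E. tail E g = v \<and> head E g = x}"
    and "countable {g \<in> arcs E. tail E g = v \<and> head E g = x}"
    and "infinite {g \<in> arcs E. tail E g = w \<and> head E g = x}"
    and "countable {g \<in> arcs E. tail E g = w \<and> head E g = x}"
    and "\<forall>g \<in> arcs E. (tail E g, head E g) \<in> {(v, w), (w, v), (v, x), (w, x)}"
  shows "admissible_pair E {x} {v, w} \<and>
         \<not> cstar_isomorphic (pair_ideal_cstar E {x} {v, w})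
             (graph_cstar (DHS_graph E {x} {v, w}))"
proof -
  interpret two_cycle E v w x e f by (rule two_cycle.intro) fact+
  let ?I = "pair_ideal_cstar E {x} {v, w}" and ?G = "DHS_graph E {x} {v, w}"
  have "wf_digraph ?G"
    using admissible by (intro wf_DHS_graph) (simp add: admissible_pair_def)
  then obtain u where u: "u \<in> carr (graph_cstar ?G)"
      "\<And>\<xi>. \<xi> \<in> carr (graph_cstar ?G) \<Longrightarrow> cmult (graph_cstar ?G) u \<xi> = \<xi>"
    using graph_cstar_left_unit[OF _ finite_verts_DHS] by blast
  have False
    if \<phi>: "star_hom ?I (graph_cstar ?G) \<phi>" "bij_betw \<phi> (carr ?I) (carr (graph_cstar ?G))" for \<phi>
  proof -
    have closed: "cmult ?I \<xi> \<eta> \<in> carr ?I" if "\<xi> \<in> carr ?I" "\<eta> \<in> carr ?I" for \<xi> \<eta>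
      using that subsetD[OF pair_ideal_subset(2)]
      by (auto simp: pair_ideal_cstar_def pair_ideal_def intro!: ideal_generated_mult)
    obtain u' where "u' \<in> carr ?I" "\<And>\<xi>. \<xi> \<in> carr ?I \<Longrightarrow> cmult ?I u' \<xi> = \<xi>"
      using left_unit_transfer[OF \<phi> closed u] by blast
    then show False
      \<comment> \<open>\<open>pair_ideal_cstar\<close> changes only the carrier, so
        \<open>u'\<close> is a left unit for the product of \<open>graph_cstar E\<close>.\<close>
      by (intro pair_ideal_no_left_unit[of u']) (simp_all add: pair_ideal_cstar_def)
  qed
  with admissible show ?thesis by (auto simp: cstar_isomorphic_def)
qed

end
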